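(* Let $\alpha\in(-1,1)$, $\beta=(1-\alpha)/2$, and assume $1/\beta$ is not an integer. Let $\kappa$ be the smallest integer strictly greater than $1/\beta$ and $c(\beta)=(\kappa-1/\beta+1)/2\in(1/2,1)$. Let $\gamma=1/(1+\beta v_x/v_y)$ and $\xi=(1-\gamma)(v_y/\gamma)^{1/2}$. Let $\pi$ be a prior such that $m_\pi$ is positive, twice continuously differentiable, and all expectations involved are finite (with differentiation under integrals justified). If $$\Delta_u\left\{E_{Z_1}\!\left[m_\pi^{\kappa}(tZ_1+u,\,v_x\gamma)\right]\right\}^{c(\beta)/\kappa}\le 0\quad\text{for all }u\in\mathbb{R}^d,\ 0\le t\le\xi,$$ where $Z_1\sim N_d(0,I)$, then $R_\alpha(\mu;\hat p_\pi)\le R_\alpha(\mu;\hat p_U)$ for all $\mu\in\mathbb{R}^d$.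
   Context: Let $d\ge 3$, $v_x,v_y>0$ known; $X\sim N_d(\mu,v_xI)$, $Y\sim N_d(\mu,v_yI)$ independent. $\phi(\cdot,\sigma^2)$ is the $N_d(0,\sigma^2I)$ density; $m_\pi(x,v)=\int\phi(x-\mu,v)\pi(\mu)d\mu$. The Bayes predictive density is $\hat p_\pi(y\mid x;\alpha)=\frac{m_\pi^{1/\beta}(\gamma x+(1-\gamma)y,v_x\gamma)}{E_{Z_1}[m_\pi^{1/\beta}(x+\xi Z_1,v_x\gamma)]}\phi(y-x,v_y/\gamma)$, and $\hat p_U(y\mid x;\alpha)=\phi(y-x,v_y+\beta v_x)$ (the case $\pi\equiv1$). The $\alpha$-divergence loss is $D_\alpha=\int f_\alpha\!\left(\hat p(y\mid x)/\phi(y-\mu,v_y)\right)\phi(y-\mu,v_y)\,dy$ with $f_\alpha(z)=\frac{4}{1-\alpha^2}(1-z^{(1+\alpha)/2})$, and the risk is $R_\alpha(\mu;\hat p)=\int D_\alpha\,\phi(x-\mu,v_x)\,dx$. *)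

theory Defs
  imports "HOL-Analysis.Analysis"
begin

definition gauss :: "'a::euclidean_space \<Rightarrow> real \<Rightarrow> real" where
  "gauss x s = (2 * pi * s) powr (- real DIM('a) / 2) * exp (- (norm x)\<^sup>2 / (2 * s))"

text \<open>Marginal m_pi(x,v) = integral of phi(x - mu, v) pi(mu) d mu (prior pi may be improper).\<close>
definition marg :: "('a::euclidean_space \<Rightarrow> real) \<Rightarrow> 'a \<Rightarrow> real \<Rightarrow> real" where
  "marg prior x v = (\<integral>\<mu>. gauss (x - \<mu>) v * prior \<mu> \<partial>lborel)"

definition EZ :: "('a::euclidean_space \<Rightarrow> real) \<Rightarrow> real" where
  "EZ h = (\<integral>z. h z * gauss z 1 \<partial>lborel)"

definition beta_of :: "real \<Rightarrow> real" where "beta_of \<alpha> = (1 - \<alpha>) / 2"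
definition gamma_of :: "real \<Rightarrow> real \<Rightarrow> real \<Rightarrow> real" where
  "gamma_of \<alpha> vx vy = 1 / (1 + beta_of \<alpha> * vx / vy)"
definition xi_of :: "real \<Rightarrow> real \<Rightarrow> real \<Rightarrow> real" where
  "xi_of \<alpha> vx vy = (1 - gamma_of \<alpha> vx vy) * sqrt (vy / gamma_of \<alpha> vx vy)"
definition kappa_of :: "real \<Rightarrow> int" where
  "kappa_of \<alpha> = (LEAST k::int. k > 0 \<and> real_of_int k > 1 / beta_of \<alpha>)"
definition c_of :: "real \<Rightarrow> real" where
  "c_of \<alpha> = (real_of_int (kappa_of \<alpha>) - 1 / beta_of \<alpha> + 1) / 2"

definition bayes_pred :: "('a::euclidean_space \<Rightarrow> real) \<Rightarrow> real \<Rightarrow> real \<Rightarrow> real \<Rightarrow> 'a \<Rightarrow> 'a \<Rightarrow> real" where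
  "bayes_pred prior vx vy \<alpha> x y =
     (let \<beta> = beta_of \<alpha>; \<gamma> = gamma_of \<alpha> vx vy; \<xi> = xi_of \<alpha> vx vy in
      marg prior (\<gamma> *\<^sub>R x + (1 - \<gamma>) *\<^sub>R y) (vx * \<gamma>) powr (1 / \<beta>)
        / EZ (\<lambda>z. marg prior (x + \<xi> *\<^sub>R z) (vx * \<gamma>) powr (1 / \<beta>))
        * gauss (y - x) (vy / \<gamma>))"

definition unif_pred :: "real \<Rightarrow> real \<Rightarrow> real \<Rightarrow> 'a::euclidean_space \<Rightarrow> 'a \<Rightarrow> real" where
  "unif_pred vx vy \<alpha> x y = gauss (y - x) (vy + beta_of \<alpha> * vx)"

definition f_alpha :: "real \<Rightarrow> real \<Rightarrow> real" where
  "f_alpha \<alpha> z = 4 / (1 - \<alpha>\<^sup>2) * (1 - z powr ((1 + \<alpha>) / 2))"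

definition alpha_div :: "real \<Rightarrow> real \<Rightarrow> ('a::euclidean_space \<Rightarrow> 'a \<Rightarrow> real) \<Rightarrow> 'a \<Rightarrow> 'a \<Rightarrow> real" where
  "alpha_div \<alpha> vy p \<mu> x =
     (\<integral>y. f_alpha \<alpha> (p x y / gauss (y - \<mu>) vy) * gauss (y - \<mu>) vy \<partial>lborel)"

definition risk :: "real \<Rightarrow> real \<Rightarrow> real \<Rightarrow> ('a::euclidean_space \<Rightarrow> 'a \<Rightarrow> real) \<Rightarrow> 'a \<Rightarrow> real" where
  "risk \<alpha> vx vy p \<mu> = (\<integral>x. alpha_div \<alpha> vy p \<mu> x * gauss (x - \<mu>) vx \<partial>lborel)"

definition laplacian :: "('a::euclidean_space \<Rightarrow> real) \<Rightarrow> 'a \<Rightarrow> real" where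
  "laplacian F u = (\<Sum>b\<in>Basis. deriv (\<lambda>s. deriv (\<lambda>t. F (u + t *\<^sub>R b)) s) 0)"

definition C2 :: "('a::euclidean_space \<Rightarrow> real) \<Rightarrow> bool" where
  "C2 F \<longleftrightarrow> (\<exists>F' F''. (\<forall>x. (F has_derivative blinfun_apply (F' x)) (at x)) \<and>
                       (\<forall>x. (F' has_derivative blinfun_apply (F'' x)) (at x)) \<and>
                       continuous_on UNIV F'')"

end

theory Submission
  imports Defs "HOL-Probability.Probability" "HOL-Real_Asymp.Real_Asymp"
begin

text \<open>
Write \<open>q = 1 / \<beta>\<close>, \<open>m = m\<^sub>\<pi>(\<cdot>, v\<^sub>x\<gamma>)\<close>, \<open>p = (q - 1) / \<kappa>\<close>, let \<open>P\<^sub>t\<close> be the heat semigroup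
\<open>P\<^sub>t f(x) = E f(x + \<surd>t Z)\<close>, and put \<open>K\<^sub>t = P\<^sub>t(m\<^sup>\<kappa>)\<close>.  Completing the square and
Tonelli's theorem reduce the risk comparison to a pointwise inequality
\<open>E[M(u + \<xi>Z)\<^bsup>-(1-\<beta>)\<^esup>] \<ge> m(u)\<^bsup>-(q-1)\<^esup>\<close> with \<open>M(x) = E[m\<^sup>q(x + \<xi>Z)]\<close>, and since
\<open>M \<le> K\<^bsub>\<xi>\<^sup>2\<^esub>\<^bsup>q/\<kappa>\<^esup>\<close> it is enough that \<open>P\<^sub>\<tau>(K\<^sub>\<tau>\<^bsup>-p\<^esup>) \<ge> K\<^sub>0\<^bsup>-p\<^esup>\<close> for \<open>\<tau> = \<xi>\<^sup>2\<close>.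

As \<open>K\<close> solves the heat equation, \<open>(\<partial>\<^sub>t + \<Delta>/2) K\<^bsup>-p\<^esup>\<close> is a nonpositive multiple of
\<open>\<Delta>(K\<^bsup>(1-p)/2\<^esup>)\<close>, and \<open>(1 - p) / 2 = c(\<beta>) / \<kappa>\<close>; so the hypothesis says that \<open>K\<^bsup>-p\<^esup>\<close> is a
subsolution of the backward heat equation.  The maximum principle bounds it by the solution
\<open>P\<^bsub>\<tau>-t\<^esub>(K\<^sub>\<tau>\<^bsup>-p\<^esup>)\<close> with the same data at \<open>t = \<tau>\<close>.  The growth condition needed at infinity comes
from the hypothesis as well: comparison of the positive superharmonic function
\<open>K\<^sub>t\<^bsup>(1-p)/2\<^esup>\<close> with Gaussians shows that it decays more slowly than any \<open>exp(-\<delta>|x|\<^sup>2)\<close>.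
\<close>

section \<open>Gaussian kernels\<close>

text \<open>Along a Brownian motion B started at u, \<open>K_t(B_t)^(-p)\<close> is formally a
  submartingale; comparing its means at the times 0 and \<tau> is the inequality wanted. What shapes
  the rigorous version is that \<open>m^\<kappa>\<close> comes with continuity and Gaussian
  integrability only, without a growth bound. So no dominating function is at hand that makes
  \<open>K_t(x)\<close> continuous in (t, x) up to both ends of the time interval, and derivatives
  are controlled only for 0 < t < \<tau>, where the Gaussian of variance \<tau> dominates the
  kernels of smaller variance. Fatou's lemma still gives lower semicontinuity, and the signs fit:
  the difference of the two functions compared is upper semicontinuous and attains its maximum on
  compact sets. Regularity at t = \<tau> itself is taken from the hypothesis.

  Passing from the exponent q to \<kappa> is Jensen's inequality, which asks for \<kappa> \<ge> q;
  the same bound makes p < 1 and the exponent (1 - p) / 2 positive.\<close>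

lemma sum_basis_inner_power2: "(\<Sum>b\<in>Basis. (x \<bullet> b)\<^sup>2) = (norm (x::'a::euclidean_space))\<^sup>2"
  unfolding power2_norm_eq_inner by (subst euclidean_inner) (simp add: power2_eq_square)

lemma gauss_pos: "s > 0 \<Longrightarrow> gauss x s > 0"
  by (simp add: gauss_def)

lemma gauss_nonneg [simp]: "0 \<le> gauss x s"
  by (simp add: gauss_def)

lemma continuous_on_gauss: "continuous_on UNIV (\<lambda>x::'a::euclidean_space. gauss x s)"
  unfolding gauss_def divide_inverse by (intro continuous_intros)

lemma gauss_measurable [measurable]:
  "f \<in> borel_measurable M \<Longrightarrow> (\<lambda>x. gauss (f x :: 'a::euclidean_space) s) \<in> borel_measurable M"
  by (rule measurable_compose[OF _ borel_measurable_continuous_onI[OF continuous_on_gauss]])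

lemma gauss_scale:
  fixes x :: "'a::euclidean_space"
  assumes "c > 0" "s > 0"
  shows "c ^ DIM('a) * gauss (c *\<^sub>R x) (c\<^sup>2 * s) = gauss x s"
proof -
  have "(2 * pi * (c\<^sup>2 * s)) powr (- real DIM('a) / 2)
      = (c\<^sup>2) powr (- real DIM('a) / 2) * (2 * pi * s) powr (- real DIM('a) / 2)"
    using assms by (subst powr_mult [symmetric]) (auto simp: mult_ac)
  also have "(c\<^sup>2) powr (- real DIM('a) / 2) = inverse (c ^ DIM('a))"
  proof -
    have "(c\<^sup>2) powr (- real DIM('a) / 2) = c powr (- real DIM('a))"
      using assms by (simp add: powr_powr flip: powr_numeral)
    also have "\<dots> = inverse (c ^ DIM('a))"
      using assms by (simp add: powr_minus powr_realpow)
    finally show ?thesis .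
  qed
  finally show ?thesis
    using assms by (simp add: gauss_def power_mult_distrib field_simps)
qed

lemma nn_integral_gauss_1: "(\<integral>\<^sup>+x. ennreal (gauss (x::'a::euclidean_space) 1) \<partial>lborel) = 1"
proof -
  have *: "gauss x 1 = (\<Prod>b\<in>Basis. normal_density 0 1 (x \<bullet> b))" for x :: 'a
  proof -
    have "(norm x)\<^sup>2 = (\<Sum>b\<in>Basis. (x \<bullet> b)\<^sup>2)"
      by (simp add: sum_basis_inner_power2)
    moreover have "(2 * pi) powr (- real DIM('a) / 2) = (1 / sqrt (2 * pi)) ^ DIM('a)"
    proof -
      have "(1 / sqrt (2 * pi)) ^ DIM('a) = ((2 * pi) powr (- 1 / 2)) powr real DIM('a)"
        by (simp add: powr_realpow powr_minus_divide powr_half_sqrt)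
      then show ?thesis by (simp add: powr_powr)
    qed
    ultimately show ?thesis
      by (simp add: gauss_def normal_density_def prod.distrib prod_dividef power_one_over
            sum_divide_distrib exp_sum flip: sum_negf)
  qed
  have "(\<integral>\<^sup>+x. ennreal (gauss (x::'a) 1) \<partial>lborel)
      = (\<integral>\<^sup>+x. (\<Prod>b\<in>Basis. ennreal (normal_density 0 1 (x \<bullet> b))) \<partial>(lborel :: 'a measure))"
    by (simp add: * prod_ennreal)
  also have "\<dots> = (\<Prod>b\<in>(Basis::'a set). (\<integral>\<^sup>+x. ennreal (normal_density 0 1 x) \<partial>lborel))"
    by (rule nn_integral_lborel_prod) auto
  also have "\<dots> = 1"
    by (simp add: nn_integral_eq_integral)
  finally show ?thesis .
qed

lemma nn_integral_lborel_affine: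
  fixes f :: "'a::euclidean_space \<Rightarrow> ennreal"
  assumes [measurable]: "f \<in> borel_measurable borel" and "c \<noteq> 0"
  shows "(\<integral>\<^sup>+x. f x \<partial>lborel) = ennreal (\<bar>c\<bar> ^ DIM('a)) * (\<integral>\<^sup>+x. f (t + c *\<^sub>R x) \<partial>lborel)"
  by (subst lborel_affine[OF assms(2), of t])
     (simp add: nn_integral_density nn_integral_distr nn_integral_cmult)

lemma nn_integral_gauss_affine:
  fixes f :: "'a::euclidean_space \<Rightarrow> ennreal"
  assumes [measurable]: "f \<in> borel_measurable borel" and "s > 0"
  shows "(\<integral>\<^sup>+y. f y * gauss (y - x) s \<partial>lborel) = (\<integral>\<^sup>+z. f (x + sqrt s *\<^sub>R z) * gauss z 1 \<partial>lborel)"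
proof -
  have "(\<integral>\<^sup>+y. f y * gauss (y - x) s \<partial>lborel)
      = ennreal (sqrt s ^ DIM('a)) * (\<integral>\<^sup>+z. f (x + sqrt s *\<^sub>R z) * gauss (sqrt s *\<^sub>R z) s \<partial>lborel)"
    by (subst nn_integral_lborel_affine[where c="sqrt s" and t=x]) (use assms in auto)
  also have "\<dots> = (\<integral>\<^sup>+z. ennreal (sqrt s ^ DIM('a)) * (f (x + sqrt s *\<^sub>R z) * gauss (sqrt s *\<^sub>R z) s) \<partial>lborel)"
    by (rule nn_integral_cmult [symmetric]) auto
  also have "\<dots> = (\<integral>\<^sup>+z. f (x + sqrt s *\<^sub>R z) * gauss z 1 \<partial>lborel)"
  proof (rule nn_integral_cong)
    fix z :: 'a
    have "ennreal (gauss z 1) = ennreal (sqrt s ^ DIM('a)) * ennreal (gauss (sqrt s *\<^sub>R z) s)"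
      using gauss_scale[of "sqrt s" 1 z] assms by (simp flip: ennreal_mult)
    then show "ennreal (sqrt s ^ DIM('a)) * (f (x + sqrt s *\<^sub>R z) * gauss (sqrt s *\<^sub>R z) s)
        = f (x + sqrt s *\<^sub>R z) * gauss z 1"
      by (simp add: mult_ac)
  qed
  finally show ?thesis .
qed

lemma nn_integral_gauss:
  assumes "s > 0"
  shows "(\<integral>\<^sup>+y. ennreal (gauss (y - x :: 'a::euclidean_space) s) \<partial>lborel) = 1"
  using nn_integral_gauss_affine[of "\<lambda>_. 1" s x] assms by (simp add: nn_integral_gauss_1)

lemma integrable_gauss:
  assumes "s > 0"
  shows "integrable lborel (\<lambda>y::'a::euclidean_space. gauss (y - x) s)"
  by (rule integrableI_nonneg) (use nn_integral_gauss[OF assms, of x] in auto)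

lemma integral_gauss:
  assumes "s > 0"
  shows "(\<integral>y. gauss (y - x :: 'a::euclidean_space) s \<partial>lborel) = 1"
  using nn_integral_gauss[OF assms, of x] by (subst integral_eq_nn_integral) auto

text \<open>Nonnegativity lets one identity of extended integrals deliver integrability and value
  together. It links the two forms of the semigroup: a fixed function against a moving kernel, good
  for differentiating, and a moving function against a fixed kernel, good for limits.\<close>

lemma nonneg_integrable_integral_gauss_affine:
  fixes f :: "'a::euclidean_space \<Rightarrow> real"
  assumes [measurable]: "f \<in> borel_measurable borel" and "s > 0" and nn: "\<And>x. f x \<ge> 0"
  shows "integrable lborel (\<lambda>y. f y * gauss (y - x) s)
           \<longleftrightarrow> integrable lborel (\<lambda>z. f (x + sqrt s *\<^sub>R z) * gauss z 1)"
    and "(\<integral>y. f y * gauss (y - x) s \<partial>lborel) = (\<integral>z. f (x + sqrt s *\<^sub>R z) * gauss z 1 \<partial>lborel)"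
proof -
  have eq: "(\<integral>\<^sup>+y. ennreal (f y * gauss (y - x) s) \<partial>lborel)
      = (\<integral>\<^sup>+z. ennreal (f (x + sqrt s *\<^sub>R z) * gauss z 1) \<partial>lborel)"
    using nn_integral_gauss_affine[of "\<lambda>y. ennreal (f y)" s x] assms by (simp add: ennreal_mult)
  show "(\<integral>y. f y * gauss (y - x) s \<partial>lborel) = (\<integral>z. f (x + sqrt s *\<^sub>R z) * gauss z 1 \<partial>lborel)"
    by (simp add: integral_eq_nn_integral nn eq)
  show "integrable lborel (\<lambda>y. f y * gauss (y - x) s)
           \<longleftrightarrow> integrable lborel (\<lambda>z. f (x + sqrt s *\<^sub>R z) * gauss z 1)"
    by (simp add: integrable_iff_bounded nn eq)
qed

section \<open>The heat equation\<close>

lemma has_real_derivative_integral_dominated: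
  fixes \<theta> \<theta>' :: "real \<Rightarrow> 'b \<Rightarrow> real"
  assumes "e > 0"
    and int: "\<And>r. \<bar>r - r0\<bar> < e \<Longrightarrow> integrable M (\<theta> r)"
    and der: "\<And>r y. \<bar>r - r0\<bar> < e \<Longrightarrow> ((\<lambda>r. \<theta> r y) has_real_derivative \<theta>' r y) (at r)"
    and dom: "\<And>r y. \<bar>r - r0\<bar> < e \<Longrightarrow> \<bar>\<theta>' r y\<bar> \<le> B y"
    and B: "integrable M B" and meas: "\<theta>' r0 \<in> borel_measurable M"
  shows "((\<lambda>r. \<integral>y. \<theta> r y \<partial>M) has_real_derivative (\<integral>y. \<theta>' r0 y \<partial>M)) (at r0)"
  unfolding DERIV_def LIMSEQ_SEQ_conv [symmetric]
proof (intro allI impI)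
  fix S :: "nat \<Rightarrow> real"
  assume S: "(\<forall>n. S n \<noteq> 0) \<and> S \<longlonglongrightarrow> 0"
  then have "eventually (\<lambda>n. \<bar>S n\<bar> < e) sequentially"
    using \<open>e > 0\<close> by (auto simp: tendsto_iff dist_real_def)
  \<comment> \<open>Dropping the first N terms keeps every increment inside the interval, so that
    the mean value inequality bounds all remaining quotients by \<open>B\<close>.\<close>
  then obtain N where N: "\<And>n. \<bar>S (n + N)\<bar> < e"
    unfolding eventually_sequentially by (metis le_add2)
  let ?q = "\<lambda>n y. (\<theta> (r0 + S (n + N)) y - \<theta> r0 y) / S (n + N)"
  have int0: "integrable M (\<theta> r0)" "integrable M (\<theta> (r0 + S (n + N)))" for n
    using int[of r0] int[of "r0 + S (n + N)"] N[of n] \<open>e > 0\<close> by auto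
  have "(\<lambda>n. \<integral>y. ?q n y \<partial>M) \<longlonglongrightarrow> (\<integral>y. \<theta>' r0 y \<partial>M)"
  proof (rule integral_dominated_convergence[OF meas _ B])
    show "?q n \<in> borel_measurable M" for n
      using int0 by (auto dest!: borel_measurable_integrable)
    show "AE y in M. (\<lambda>n. ?q n y) \<longlonglongrightarrow> \<theta>' r0 y"
    proof (rule AE_I2)
      fix y
      have "(\<lambda>h. (\<theta> (r0 + h) y - \<theta> r0 y) / h) \<midarrow>0\<rightarrow> \<theta>' r0 y"
        using der[of r0 y] \<open>e > 0\<close> by (simp add: DERIV_def)
      then have "(\<lambda>n. (\<theta> (r0 + S n) y - \<theta> r0 y) / S n) \<longlonglongrightarrow> \<theta>' r0 y"
        using S unfolding LIMSEQ_SEQ_conv [symmetric] by blast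
      then show "(\<lambda>n. ?q n y) \<longlonglongrightarrow> \<theta>' r0 y" by (rule LIMSEQ_ignore_initial_segment)
    qed
    show "AE y in M. norm (?q n y) \<le> B y" for n
    proof (rule AE_I2)
      fix y
      have "norm (\<theta> (r0 + S (n + N)) y - \<theta> r0 y) \<le> B y * norm (r0 + S (n + N) - r0)"
      proof (rule field_differentiable_bound[where S="ball r0 e" and f'="\<lambda>r. \<theta>' r y"])
        show "((\<lambda>r. \<theta> r y) has_real_derivative \<theta>' z y) (at z within ball r0 e)" if "z \<in> ball r0 e" for z
          using der[of z y] that by (auto simp: dist_real_def abs_minus_commute intro: DERIV_subset)
        show "norm (\<theta>' z y) \<le> B y" if "z \<in> ball r0 e" for z
          using dom[of z y] that by (auto simp: dist_real_def abs_minus_commute)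
      qed (use N[of n] \<open>e > 0\<close> in \<open>auto simp: dist_real_def\<close>)
      moreover have "S (n + N) \<noteq> 0" using S by auto
      ultimately show "norm (?q n y) \<le> B y"
        by (simp add: divide_le_eq)
    qed
  qed
  moreover have "(\<integral>y. ?q n y \<partial>M)
      = ((\<integral>y. \<theta> (r0 + S (n + N)) y \<partial>M) - (\<integral>y. \<theta> r0 y \<partial>M)) / S (n + N)" for n
    using int0 by (subst integral_divide_zero) simp
  ultimately have "(\<lambda>n. ((\<integral>y. \<theta> (r0 + S (n + N)) y \<partial>M) - (\<integral>y. \<theta> r0 y \<partial>M)) / S (n + N))
      \<longlonglongrightarrow> (\<integral>y. \<theta>' r0 y \<partial>M)" by (simp only:)
  then show "(\<lambda>n. ((\<integral>y. \<theta> (r0 + S n) y \<partial>M) - (\<integral>y. \<theta> r0 y \<partial>M)) / S n) \<longlonglongrightarrow> (\<integral>y. \<theta>' r0 y \<partial>M)"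
    by (rule LIMSEQ_offset)
qed

section \<open>Domination and derivatives of the kernel\<close>

lemma power2_add_divide_le:
  fixes n r p q :: real
  assumes "p > 0" "q > 0"
  shows "(n + r)\<^sup>2 / (p + q) \<le> n\<^sup>2 / p + r\<^sup>2 / q"
proof -
  have "n\<^sup>2 / p + r\<^sup>2 / q - (n + r)\<^sup>2 / (p + q) = (n * q - r * p)\<^sup>2 / (p * q * (p + q))"
    using assms by (simp add: field_simps power2_eq_square)
  also have "\<dots> \<ge> 0" using assms by simp
  finally show ?thesis by simp
qed

text \<open>Cauchy-Schwarz in Engel form. Read through the exponential, it says that shifting the
  centre of a Gaussian is paid for by enlarging its variance, up to a factor that depends on the
  shift alone.\<close>

lemma norm_add_power2_divide_le:
  fixes x y :: "'a::real_normed_vector"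
  assumes "p > 0" "q > 0"
  shows "(norm (x + y))\<^sup>2 / (p + q) \<le> (norm x)\<^sup>2 / p + (norm y)\<^sup>2 / q"
proof -
  have "(norm (x + y))\<^sup>2 / (p + q) \<le> (norm x + norm y)\<^sup>2 / (p + q)"
    using assms by (intro divide_right_mono power_mono norm_triangle_ineq) auto
  also have "\<dots> \<le> (norm x)\<^sup>2 / p + (norm y)\<^sup>2 / q"
    by (rule power2_add_divide_le[OF assms])
  finally show ?thesis .
qed

text \<open>The gap between \<open>s1\<close> and \<tau> is spent in two halves: from
  \<open>s1\<close> to \<open>s2\<close> the surplus decay absorbs the quadratic factor, from
  \<open>s2\<close> to \<tau> it absorbs the displacement of the centre. The bound is uniform in
  variance and centre, so one function dominates all the difference quotients.\<close>

lemma gauss_moment_le_exp: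
  assumes "0 < s0" "s1 < \<tau>"
  obtains C where "C > 0"
    "\<And>s x y::'a::euclidean_space. \<lbrakk>s0 \<le> s; s \<le> s1; norm x \<le> R\<rbrakk>
       \<Longrightarrow> gauss (y - x) s * (1 + (norm (y - x))\<^sup>2) \<le> C * exp (- (norm y)\<^sup>2 / (2 * \<tau>))"
proof (cases "s0 \<le> s1")
  case False
  then show ?thesis by (intro that[of 1]) auto
next
  case True
  define s2 where "s2 = (s1 + \<tau>) / 2"
  have s2: "s1 < s2" "s2 < \<tau>" "0 < s1" "0 < s2" using assms True by (auto simp: s2_def)
  define \<eta> where "\<eta> = 1 / (2 * s1) - 1 / (2 * s2)"
  have \<eta>: "\<eta> > 0" using s2 by (simp add: \<eta>_def field_simps)
  define A where "A = (2 * pi * s0) powr (- real DIM('a) / 2)"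
  define C where "C = A * (1 + 1 / \<eta>) * exp (R\<^sup>2 / (2 * (\<tau> - s2)))"
  have "A > 0" using assms by (simp add: A_def)
  show ?thesis
  proof (rule that)
    show "C > 0" using \<open>A > 0\<close> \<eta> by (auto simp: C_def intro!: mult_pos_pos add_pos_pos)
    fix s and x y :: 'a
    assume s: "s0 \<le> s" "s \<le> s1" and x: "norm x \<le> R"
    define W where "W = (norm (y - x))\<^sup>2"
    have W: "W \<ge> 0" by (simp add: W_def)
    have 1: "(2 * pi * s) powr (- real DIM('a) / 2) \<le> A"
      unfolding A_def using assms s by (intro powr_mono2') auto
    have "W / s1 \<le> W / s" using W s assms by (intro divide_left_mono) auto
    then have "exp (- W / (2 * s)) \<le> exp (- W / (2 * s1))" by simp
    also have "\<dots> = exp (- W / (2 * s2)) * exp (- \<eta> * W)"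
      using s2 by (simp add: \<eta>_def field_simps flip: exp_add)
    finally have 2: "exp (- W / (2 * s)) \<le> exp (- W / (2 * s2)) * exp (- \<eta> * W)" .
    have "W * exp (- \<eta> * W) \<le> 1 / \<eta>"
    proof -
      have "\<eta> * W \<le> exp (\<eta> * W)" using exp_ge_add_one_self[of "\<eta> * W"] by linarith
      then show ?thesis using \<eta> by (simp add: exp_minus field_simps)
    qed
    moreover have "exp (- \<eta> * W) \<le> 1" using \<eta> W by simp
    ultimately have 3: "exp (- \<eta> * W) * (1 + W) \<le> 1 + 1 / \<eta>"
      unfolding distrib_left by (simp only: mult_1_right mult.commute[of W])
    have "(norm y)\<^sup>2 / \<tau> \<le> W / s2 + (norm x)\<^sup>2 / (\<tau> - s2)"
      using norm_add_power2_divide_le[of s2 "\<tau> - s2" "y - x" x] s2 by (simp add: W_def)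
    also have "\<dots> \<le> W / s2 + R\<^sup>2 / (\<tau> - s2)"
      using s2 x by (intro add_left_mono divide_right_mono power_mono) auto
    finally have "(norm y)\<^sup>2 / \<tau> \<le> W / s2 + R\<^sup>2 / (\<tau> - s2)" .
    then have "(norm y)\<^sup>2 / \<tau> / 2 \<le> W / s2 / 2 + R\<^sup>2 / (\<tau> - s2) / 2"
      by (subst add_divide_distrib[symmetric]) (rule divide_right_mono, auto)
    then have "- W / (2 * s2) \<le> R\<^sup>2 / (2 * (\<tau> - s2)) + - (norm y)\<^sup>2 / (2 * \<tau>)"
      unfolding divide_divide_eq_left mult.commute[of _ "2::real"] by linarith
    then have 4: "exp (- W / (2 * s2)) \<le> exp (R\<^sup>2 / (2 * (\<tau> - s2))) * exp (- (norm y)\<^sup>2 / (2 * \<tau>))"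
      by (simp flip: exp_add)
    have "gauss (y - x) s * (1 + W) \<le> A * (exp (- W / (2 * s2)) * exp (- \<eta> * W)) * (1 + W)"
      unfolding gauss_def W_def[symmetric] using 1 2 W \<open>A > 0\<close>
      by (intro mult_right_mono mult_mono) auto
    also have "\<dots> = A * (exp (- W / (2 * s2)) * (exp (- \<eta> * W) * (1 + W)))" by simp
    also have "\<dots> \<le> A * ((exp (R\<^sup>2 / (2 * (\<tau> - s2))) * exp (- (norm y)\<^sup>2 / (2 * \<tau>))) * (1 + 1 / \<eta>))"
      using 3 4 W \<open>A > 0\<close> by (intro mult_left_mono mult_mono) auto
    also have "\<dots> = C * exp (- (norm y)\<^sup>2 / (2 * \<tau>))" by (simp add: C_def)
    finally show "gauss (y - x) s * (1 + (norm (y - x))\<^sup>2) \<le> C * exp (- (norm y)\<^sup>2 / (2 * \<tau>))"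
      by (simp add: W_def)
  qed
qed

lemma has_real_derivative_gauss_time:
  fixes w :: "'a::euclidean_space"
  assumes "s > 0"
  shows "((\<lambda>s. gauss w s) has_real_derivative
           gauss w s * ((norm w)\<^sup>2 / s\<^sup>2 - real DIM('a) / s) / 2) (at s)"
proof -
  have "((2 * pi * s) powr (- real DIM('a) / 2 - 1)) = (2 * pi * s) powr (- real DIM('a) / 2) / (2 * pi * s)"
    using assms by (simp add: powr_diff)
  then show ?thesis
    unfolding gauss_def using assms
    by (auto intro!: derivative_eq_intros simp: field_simps power2_eq_square)
qed

lemma has_real_derivative_gauss_space:
  fixes w b :: "'a::euclidean_space"
  assumes "s > 0"
  shows "((\<lambda>r. gauss (w - r *\<^sub>R b) s) has_real_derivative
           gauss (w - r *\<^sub>R b) s * (((w - r *\<^sub>R b) \<bullet> b) / s)) (at r)"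
proof -
  have "((\<lambda>r. (2 * pi * s) powr (- real DIM('a) / 2) *
             exp (- ((w - r *\<^sub>R b) \<bullet> (w - r *\<^sub>R b)) / (2 * s))) has_real_derivative
         (2 * pi * s) powr (- real DIM('a) / 2) *
             exp (- ((w - r *\<^sub>R b) \<bullet> (w - r *\<^sub>R b)) / (2 * s)) * (((w - r *\<^sub>R b) \<bullet> b) / s)) (at r)"
    using assms by (auto intro!: derivative_eq_intros
        simp: inner_diff_left inner_diff_right algebra_simps inner_commute add_divide_distrib diff_divide_distrib)
  then show ?thesis by (simp add: gauss_def power2_norm_eq_inner)
qed

lemma has_real_derivative_gauss_space2:
  fixes w b :: "'a::euclidean_space"
  assumes "s > 0" "norm b = 1"
  shows "((\<lambda>r. gauss (w - r *\<^sub>R b) s * (((w - r *\<^sub>R b) \<bullet> b) / s)) has_real_derivative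
           gauss (w - r *\<^sub>R b) s * (((w - r *\<^sub>R b) \<bullet> b)\<^sup>2 / s\<^sup>2 - 1 / s)) (at r)"
proof -
  have "b \<bullet> b = 1" using assms by (simp add: norm_eq_1)
  then have "((\<lambda>r. ((w - r *\<^sub>R b) \<bullet> b) / s) has_real_derivative - 1 / s) (at r)"
    using assms by (auto intro!: derivative_eq_intros simp: inner_diff_left)
  from DERIV_mult[OF has_real_derivative_gauss_space[OF assms(1)] this] show ?thesis
    by (rule DERIV_cong) (use assms in \<open>simp add: field_simps power2_eq_square\<close>)
qed


text \<open>The kernel itself solves the heat equation, and each derivative of it that occurs is the
  kernel times a polynomial of degree at most two in y - x, hence dominated by the weight of
  variance \<tau>. This is why s stays strictly below \<tau>.\<close>

lemma heat_equation:
  fixes g :: "'a::euclidean_space \<Rightarrow> real"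
  assumes g [measurable]: "g \<in> borel_measurable borel"
    and int: "integrable lborel (\<lambda>y. g y * exp (- (norm y)\<^sup>2 / (2 * \<tau>)))"
    and s: "0 < s" "s < \<tau>"
  obtains U1 U2 where
    "\<And>b x. b \<in> Basis \<Longrightarrow> ((\<lambda>r. \<integral>y. g y * gauss (y - (x + r *\<^sub>R b)) s \<partial>lborel) has_real_derivative U1 b x) (at 0)"
    "\<And>b x. b \<in> Basis \<Longrightarrow> ((\<lambda>r. U1 b (x + r *\<^sub>R b)) has_real_derivative U2 b x) (at 0)"
    "\<And>x. ((\<lambda>s. \<integral>y. g y * gauss (y - x) s \<partial>lborel) has_real_derivative (\<Sum>b\<in>Basis. U2 b x) / 2) (at s)"
proof -
  let ?e = "\<lambda>y::'a. exp (- (norm y)\<^sup>2 / (2 * \<tau>))"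
  have bound: "integrable lborel (\<lambda>y. g y * k y)"
    if [measurable]: "k \<in> borel_measurable borel" and k: "\<And>y. \<bar>k y\<bar> \<le> C * ?e y" for k :: "'a \<Rightarrow> real" and C
  proof (rule Bochner_Integration.integrable_bound)
    show "integrable lborel (\<lambda>y. C * (g y * ?e y))" using int by simp
    have "\<bar>g y * k y\<bar> \<le> \<bar>C * (g y * ?e y)\<bar>" for y
      using mult_left_mono[OF order.trans[OF k abs_ge_self], of "\<bar>g y\<bar>" y] by (simp add: abs_mult mult_ac)
    then show "AE y in lborel. norm (g y * k y) \<le> norm (C * (g y * ?e y))" by simp
  qed simp
  have deriv: "((\<lambda>r. \<integral>y. g y * k r y \<partial>lborel) has_real_derivative (\<integral>y. g y * k' r0 y \<partial>lborel)) (at r0)"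
    if "e > 0" and [measurable]: "\<And>r. k r \<in> borel_measurable borel" "\<And>r. k' r \<in> borel_measurable borel"
      and der: "\<And>r y. \<bar>r - r0\<bar> < e \<Longrightarrow> ((\<lambda>r. k r y) has_real_derivative k' r y) (at r)"
      and k: "\<And>r y. \<bar>r - r0\<bar> < e \<Longrightarrow> \<bar>k r y\<bar> \<le> C * ?e y"
      and k': "\<And>r y. \<bar>r - r0\<bar> < e \<Longrightarrow> \<bar>k' r y\<bar> \<le> C' * ?e y"
    for k k' :: "real \<Rightarrow> 'a \<Rightarrow> real" and e r0 C C'
  proof (rule has_real_derivative_integral_dominated[OF \<open>e > 0\<close>, where B="\<lambda>y. \<bar>C' * (g y * ?e y)\<bar>"])
    show "integrable lborel (\<lambda>y. \<bar>C' * (g y * ?e y)\<bar>)" using int by simp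
    show "((\<lambda>r. g y * k r y) has_real_derivative g y * k' r y) (at r)" if "\<bar>r - r0\<bar> < e" for r y
      using der[OF that] by (rule DERIV_cmult)
    show "\<bar>g y * k' r y\<bar> \<le> \<bar>C' * (g y * ?e y)\<bar>" if "\<bar>r - r0\<bar> < e" for r y
      using mult_left_mono[OF order.trans[OF k'[OF that] abs_ge_self], of "\<bar>g y\<bar>" y]
      by (simp add: abs_mult mult_ac)
    show "integrable lborel (\<lambda>y. g y * k r y)" if "\<bar>r - r0\<bar> < e" for r
      using k[OF that] by (intro bound) auto
  qed simp
  \<comment> \<open>The time derivative needs a whole neighbourhood of s: \<open>s0 > 0\<close>
    bounds the inverse powers of the variance, \<open>s1 < \<tau>\<close> leaves room for the
    domination.\<close>
  define s0 s1 where "s0 = s / 2" and "s1 = (s + \<tau>) / 2"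
  have s01: "0 < s0" "s0 < s" "s < s1" "s1 < \<tau>" using s by (auto simp: s0_def s1_def)
  define k1 where "k1 b x y = gauss (y - x) s * (((y - x) \<bullet> b) / s)" for b x y :: 'a
  define k2 where "k2 b x y = gauss (y - x) s * (((y - x) \<bullet> b)\<^sup>2 / s\<^sup>2 - 1 / s)" for b x y :: 'a
  define U1 where "U1 b x = \<integral>y. g y * k1 b x y \<partial>lborel" for b x :: 'a
  define U2 where "U2 b x = \<integral>y. g y * k2 b x y \<partial>lborel" for b x :: 'a
  have [measurable]: "k1 b x \<in> borel_measurable borel" "k2 b x \<in> borel_measurable borel" for b x :: 'a
    unfolding k1_def k2_def by measurable
  have k0_le: "\<bar>gauss w t\<bar> \<le> gauss w t * (1 + (norm w)\<^sup>2)" for w :: 'a and t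
    by (simp add: distrib_left)
  have k1_le: "\<bar>k1 b x y\<bar> \<le> 1 / s * (gauss (y - x) s * (1 + (norm (y - x))\<^sup>2))" if "b \<in> Basis" for b x y
  proof -
    have "\<bar>(y - x) \<bullet> b\<bar> \<le> 1 + (norm (y - x))\<^sup>2"
    proof -
      have "norm (y - x) \<le> 1 + (norm (y - x))\<^sup>2"
      proof -
        have "2 * norm (y - x) \<le> (norm (y - x))\<^sup>2 + 1"
          using zero_le_power2[of "norm (y - x) - 1"] by (simp add: power2_diff)
        then show ?thesis using norm_ge_zero[of "y - x"] by linarith
      qed
      with Basis_le_norm[OF that, of "y - x"] show ?thesis by linarith
    qed
    then have "\<bar>(y - x) \<bullet> b\<bar> / s \<le> (1 + (norm (y - x))\<^sup>2) / s"
      using s by (intro divide_right_mono) auto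
    then have "gauss (y - x) s * (\<bar>(y - x) \<bullet> b\<bar> / s) \<le> gauss (y - x) s * ((1 + (norm (y - x))\<^sup>2) / s)"
      by (intro mult_left_mono) auto
    then show ?thesis using s by (simp add: k1_def abs_mult)
  qed
  have k2_le: "\<bar>k2 b x y\<bar> \<le> (1 / s\<^sup>2 + 1 / s) * (gauss (y - x) s * (1 + (norm (y - x))\<^sup>2))" if "b \<in> Basis" for b x y
  proof -
    define W where "W = (norm (y - x))\<^sup>2"
    have "((y - x) \<bullet> b)\<^sup>2 \<le> W"
      using power_mono[OF Basis_le_norm[OF that, of "y - x"], of 2] by (simp add: W_def)
    then have "((y - x) \<bullet> b)\<^sup>2 / s\<^sup>2 \<le> W / s\<^sup>2"
      by (intro divide_right_mono) auto
    have "0 \<le> ((y - x) \<bullet> b)\<^sup>2 / s\<^sup>2" "0 \<le> 1 / s" "0 \<le> 1 / s\<^sup>2" "0 \<le> W / s" using s by (auto simp: W_def)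
    then have "\<bar>((y - x) \<bullet> b)\<^sup>2 / s\<^sup>2 - 1 / s\<bar> \<le> (1 / s\<^sup>2 + 1 / s) * (1 + W)"
    proof -
      have "(1 / s\<^sup>2 + 1 / s) * (1 + W) = 1 / s\<^sup>2 + 1 / s + W / s\<^sup>2 + W / s"
        by (simp add: algebra_simps add_divide_distrib)
      then show ?thesis using \<open>((y - x) \<bullet> b)\<^sup>2 / s\<^sup>2 \<le> W / s\<^sup>2\<close> \<open>0 \<le> ((y - x) \<bullet> b)\<^sup>2 / s\<^sup>2\<close>
          \<open>0 \<le> 1 / s\<close> \<open>0 \<le> 1 / s\<^sup>2\<close> \<open>0 \<le> W / s\<close> unfolding abs_le_iff by linarith
    qed
    from mult_left_mono[OF this gauss_nonneg] show ?thesis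
      by (simp add: k2_def abs_mult W_def mult_ac)
  qed
  have d1: "((\<lambda>r. \<integral>y. g y * gauss (y - (x + r *\<^sub>R b)) s \<partial>lborel) has_real_derivative U1 b x) (at 0)"
    if b: "b \<in> Basis" for b x :: 'a
  proof -
    obtain C where C: "C > 0" "\<And>t w y::'a. \<lbrakk>s0 \<le> t; t \<le> s1; norm w \<le> norm x + 1\<rbrakk>
       \<Longrightarrow> gauss (y - w) t * (1 + (norm (y - w))\<^sup>2) \<le> C * ?e y"
      using gauss_moment_le_exp[of s0 s1 \<tau> "norm x + 1"] s01 by blast
    have nrm: "norm (x + r *\<^sub>R b) \<le> norm x + 1" if "\<bar>r\<bar> < 1" for r
      using norm_triangle_ineq[of x "r *\<^sub>R b"] b that by simp
    have "((\<lambda>r. \<integral>y. g y * gauss (y - (x + r *\<^sub>R b)) s \<partial>lborel)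
        has_real_derivative (\<integral>y. g y * k1 b (x + 0 *\<^sub>R b) y \<partial>lborel)) (at 0)"
    proof (rule deriv[where e=1 and C=C and C'="1 / s * C"])
      fix r :: real and y :: 'a
      assume r: "\<bar>r - 0\<bar> < 1"
      have "gauss (y - (x + r *\<^sub>R b)) s * (1 + (norm (y - (x + r *\<^sub>R b)))\<^sup>2) \<le> C * ?e y"
        using C(2)[of s "x + r *\<^sub>R b" y] s01 nrm[of r] r by auto
      then show "\<bar>gauss (y - (x + r *\<^sub>R b)) s\<bar> \<le> C * ?e y"
        and "\<bar>k1 b (x + r *\<^sub>R b) y\<bar> \<le> 1 / s * C * ?e y"
        using k0_le[of "y - (x + r *\<^sub>R b)" s] order.trans[OF k1_le[OF b, of "x + r *\<^sub>R b" y] mult_left_mono[of _ "C * ?e y" "1 / s"]] s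
        by (auto simp: mult_ac)
      show "((\<lambda>r. gauss (y - (x + r *\<^sub>R b)) s) has_real_derivative k1 b (x + r *\<^sub>R b) y) (at r)"
        using has_real_derivative_gauss_space[OF s(1), of "y - x" b r] by (simp add: k1_def diff_diff_eq)
    qed auto
    then show ?thesis by (simp add: U1_def)
  qed
  have d2: "((\<lambda>r. U1 b (x + r *\<^sub>R b)) has_real_derivative U2 b x) (at 0)"
    if b: "b \<in> Basis" for b x :: 'a
  proof -
    obtain C where C: "C > 0" "\<And>t w y::'a. \<lbrakk>s0 \<le> t; t \<le> s1; norm w \<le> norm x + 1\<rbrakk>
       \<Longrightarrow> gauss (y - w) t * (1 + (norm (y - w))\<^sup>2) \<le> C * ?e y"
      using gauss_moment_le_exp[of s0 s1 \<tau> "norm x + 1"] s01 by blast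
    have nrm: "norm (x + r *\<^sub>R b) \<le> norm x + 1" if "\<bar>r\<bar> < 1" for r
      using norm_triangle_ineq[of x "r *\<^sub>R b"] b that by simp
    have "((\<lambda>r. \<integral>y. g y * k1 b (x + r *\<^sub>R b) y \<partial>lborel)
        has_real_derivative (\<integral>y. g y * k2 b (x + 0 *\<^sub>R b) y \<partial>lborel)) (at 0)"
    proof (rule deriv[where e=1 and C="1 / s * C" and C'="(1 / s\<^sup>2 + 1 / s) * C"])
      fix r :: real and y :: 'a
      assume r: "\<bar>r - 0\<bar> < 1"
      have *: "gauss (y - (x + r *\<^sub>R b)) s * (1 + (norm (y - (x + r *\<^sub>R b)))\<^sup>2) \<le> C * ?e y"
        using C(2)[of s "x + r *\<^sub>R b" y] s01 nrm[of r] r by auto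
      show "\<bar>k1 b (x + r *\<^sub>R b) y\<bar> \<le> 1 / s * C * ?e y"
        using order.trans[OF k1_le[OF b, of "x + r *\<^sub>R b" y] mult_left_mono[OF *, of "1 / s"]] s
        by (simp add: mult_ac)
      show "\<bar>k2 b (x + r *\<^sub>R b) y\<bar> \<le> (1 / s\<^sup>2 + 1 / s) * C * ?e y"
        using order.trans[OF k2_le[OF b, of "x + r *\<^sub>R b" y] mult_left_mono[OF *, of "1 / s\<^sup>2 + 1 / s"]] s
        by (simp add: mult_ac)
      show "((\<lambda>r. k1 b (x + r *\<^sub>R b) y) has_real_derivative k2 b (x + r *\<^sub>R b) y) (at r)"
        using has_real_derivative_gauss_space2[OF s(1), of b "y - x" r] b by (simp add: k1_def k2_def diff_diff_eq)
    qed auto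
    then show ?thesis by (simp add: U1_def U2_def)
  qed
  have d3: "((\<lambda>s. \<integral>y. g y * gauss (y - x) s \<partial>lborel) has_real_derivative (\<Sum>b\<in>Basis. U2 b x) / 2) (at s)" for x
  proof -
    obtain C where C: "C > 0" "\<And>t w y::'a. \<lbrakk>s0 \<le> t; t \<le> s1; norm w \<le> norm x\<rbrakk>
       \<Longrightarrow> gauss (y - w) t * (1 + (norm (y - w))\<^sup>2) \<le> C * ?e y"
      using gauss_moment_le_exp[of s0 s1 \<tau> "norm x"] s01 by blast
    define e where "e = min (s - s0) (s1 - s)"
    define k' where "k' t y = gauss (y - x) t * ((norm (y - x))\<^sup>2 / t\<^sup>2 - real DIM('a) / t) / 2" for t :: real and y :: 'a
    define D where "D = (1 / s0\<^sup>2 + real DIM('a) / s0) / 2"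
    have D: "D \<ge> 0" using s01 by (simp add: D_def)
    have [measurable]: "k' t \<in> borel_measurable borel" for t unfolding k'_def by measurable
    have "((\<lambda>t. \<integral>y. g y * gauss (y - x) t \<partial>lborel) has_real_derivative (\<integral>y. g y * k' s y \<partial>lborel)) (at s)"
    proof (rule deriv[where e=e and C=C and C'="D * C"])
      fix t y assume "\<bar>t - s\<bar> < e"
      then have t: "s0 \<le> t" "t \<le> s1" "t > 0" using s01 by (auto simp: e_def)
      have *: "gauss (y - x) t * (1 + (norm (y - x))\<^sup>2) \<le> C * ?e y"
        using C(2)[of t x y] t by simp
      show "\<bar>gauss (y - x) t\<bar> \<le> C * ?e y" using k0_le[of "y - x" t] * by linarith
      show "((\<lambda>t. gauss (y - x) t) has_real_derivative k' t y) (at t)"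
        using has_real_derivative_gauss_time[OF t(3), of "y - x"] by (simp add: k'_def)
      define W where "W = (norm (y - x))\<^sup>2"
      have W: "W \<ge> 0" by (simp add: W_def)
      have "W / t\<^sup>2 \<le> W / s0\<^sup>2" using W t s01 by (intro divide_left_mono power_mono) auto
      moreover have "real DIM('a) / t \<le> real DIM('a) / s0" using t s01 by (intro divide_left_mono) auto
      moreover have "W / t\<^sup>2 \<ge> 0" "real DIM('a) / t \<ge> 0" "real DIM('a) / s0 * W \<ge> 0" "1 / s0\<^sup>2 \<ge> 0" "real DIM('a) / s0 \<ge> 0"
        using W t s01 by auto
      ultimately have "\<bar>W / t\<^sup>2 - real DIM('a) / t\<bar> / 2 \<le> D * (1 + W)"
      proof -
        assume *: "W / t\<^sup>2 \<le> W / s0\<^sup>2" "real DIM('a) / t \<le> real DIM('a) / s0" "W / t\<^sup>2 \<ge> 0"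
          "real DIM('a) / t \<ge> 0" "real DIM('a) / s0 * W \<ge> 0" "1 / s0\<^sup>2 \<ge> 0" "real DIM('a) / s0 \<ge> 0"
        have "D * (1 + W) = (1 / s0\<^sup>2 + real DIM('a) / s0 + W / s0\<^sup>2 + real DIM('a) / s0 * W) / 2"
          by (simp add: D_def algebra_simps add_divide_distrib)
        moreover have "\<bar>a - b\<bar> / 2 \<le> X" if "X = (p + b' + a' + q) / 2" "a \<le> a'" "b \<le> b'" "0 \<le> a" "0 \<le> b" "0 \<le> q" "0 \<le> p"
          for a b a' b' p q X :: real using that by (cases "a \<le> b") auto
        ultimately show ?thesis using * by blast
      qed
      from mult_left_mono[OF this gauss_nonneg, of "y - x" t]
      have "\<bar>k' t y\<bar> \<le> D * (gauss (y - x) t * (1 + W))"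
        by (simp add: k'_def abs_mult W_def mult_ac)
      also have "\<dots> \<le> D * (C * ?e y)" using * D by (intro mult_left_mono) (auto simp: W_def)
      finally show "\<bar>k' t y\<bar> \<le> D * C * ?e y" by (simp add: mult_ac)
    qed (use s01 in \<open>auto simp: e_def\<close>)
    \<comment> \<open>The heat equation of the kernel enters here: the squared components in
      \<open>k2\<close> add up to the squared norm in \<open>k'\<close>.\<close>
    also have "(\<integral>y. g y * k' s y \<partial>lborel) = (\<integral>y. (\<Sum>b\<in>Basis. g y * k2 b x y) / 2 \<partial>lborel)"
    proof (rule Bochner_Integration.integral_cong[OF refl])
      fix y :: 'a
      have "(norm (y - x))\<^sup>2 = (\<Sum>b\<in>Basis. ((y - x) \<bullet> b)\<^sup>2)"
        by (simp only: sum_basis_inner_power2)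
      then have "k' s y = (\<Sum>b\<in>Basis. k2 b x y) / 2"
        unfolding k'_def k2_def by (simp add: sum_subtractf sum_divide_distrib flip: sum_distrib_left)
      then show "g y * k' s y = (\<Sum>b\<in>Basis. g y * k2 b x y) / 2"
        by (simp only: sum_distrib_left[symmetric] times_divide_eq_right)
    qed
    also have "\<dots> = (\<Sum>b\<in>Basis. U2 b x) / 2"
    proof -
      have "integrable lborel (\<lambda>y. g y * k2 b x y)" if "b \<in> Basis" for b
      proof (rule bound)
        show "\<bar>k2 b x y\<bar> \<le> (1 / s\<^sup>2 + 1 / s) * C * ?e y" for y
          using order.trans[OF k2_le[OF that, of x y] mult_left_mono[OF C(2)[of s x y], of "1 / s\<^sup>2 + 1 / s"]] s s01
          by (simp add: mult_ac)
      qed simp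
      then show ?thesis by (simp add: U2_def Bochner_Integration.integral_sum)
    qed
    finally show ?thesis .
  qed
  show ?thesis by (rule that[OF d1 d2 d3])
qed

section \<open>The heat semigroup and superharmonic functions\<close>

text \<open>Time is the variance \<open>s\<close>, so the standard deviation t of the hypothesis
  corresponds to \<open>sqrt s\<close>. Moving the argument of \<open>g\<close> against a fixed
  Gaussian keeps s = 0 meaningful, where the density itself degenerates.\<close>

definition heat :: "('a::euclidean_space \<Rightarrow> real) \<Rightarrow> real \<Rightarrow> 'a \<Rightarrow> real" where
  "heat g s x = EZ (\<lambda>z. g (x + sqrt s *\<^sub>R z))"

lemma heat_0: "heat g 0 x = g x"
  using integral_gauss[of 1 "0::'a::euclidean_space"] by (simp add: heat_def EZ_def)

lemma heat_eq_integral_gauss: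
  assumes "g \<in> borel_measurable borel" "\<And>x. g x \<ge> 0" "s > 0"
  shows "heat g s x = (\<integral>y. g y * gauss (y - x) s \<partial>lborel)"
  unfolding heat_def EZ_def using nonneg_integrable_integral_gauss_affine(2)[of g s x] assms by simp

lemma heat_nonneg: "(\<And>x. g x \<ge> 0) \<Longrightarrow> heat g s x \<ge> 0"
  by (simp add: heat_def EZ_def)

lemma heat_pos:
  fixes g :: "'a::euclidean_space \<Rightarrow> real"
  assumes "\<And>x. g x > 0" and int: "integrable lborel (\<lambda>z. g (x + sqrt s *\<^sub>R z) * gauss z 1)"
  shows "heat g s x > 0"
proof -
  have pos: "g (x + sqrt s *\<^sub>R z) * gauss z 1 > 0" for z
    using assms(1) gauss_pos[of 1 z] by simp
  have "(\<integral>z. g (x + sqrt s *\<^sub>R z) * gauss z 1 \<partial>lborel) \<noteq> 0"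
  proof
    assume "(\<integral>z. g (x + sqrt s *\<^sub>R z) * gauss z 1 \<partial>lborel) = 0"
    then have "AE z in lborel. g (x + sqrt s *\<^sub>R z) * gauss z 1 = 0"
      by (subst (asm) integral_nonneg_eq_0_iff_AE[OF int]) (use pos in \<open>auto intro: less_imp_le\<close>)
    then have "AE z in (lborel :: 'a measure). False"
      by (rule AE_mp) (use pos in \<open>auto simp: less_le\<close>)
    then have "UNIV \<in> null_sets (lborel :: 'a measure)" by (subst (asm) AE_iff_null) simp_all
    then show False using emeasure_lborel_UNIV by (auto simp: null_sets_def)
  qed
  moreover have "(\<integral>z. g (x + sqrt s *\<^sub>R z) * gauss z 1 \<partial>lborel) \<ge> 0"
    using pos by (intro integral_nonneg_AE AE_I2 less_imp_le)
  ultimately show ?thesis by (simp add: heat_def EZ_def)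
qed

section \<open>Semicontinuity in time and space, and existence of maxima\<close>

lemma heat_le_sequentially:
  fixes g :: "'a::euclidean_space \<Rightarrow> real"
  assumes g: "continuous_on UNIV g" "\<And>x. g x \<ge> 0"
    and int: "\<And>n. integrable lborel (\<lambda>z. g (x n + sqrt (s n) *\<^sub>R z) * gauss z 1)"
    and lim: "s \<longlonglongrightarrow> s'" "x \<longlonglongrightarrow> x'"
    and le: "\<And>n::nat. heat g (s n) (x n) \<le> c"
  shows "heat g s' x' \<le> c"
proof -
  have [measurable]: "g \<in> borel_measurable borel" using g by (intro borel_measurable_continuous_onI)
  let ?f = "\<lambda>n z. ennreal (g (x n + sqrt (s n) *\<^sub>R z) * gauss z 1)"
  have c: "c \<ge> 0" by (rule order.trans[OF heat_nonneg[OF g(2)] le[of 0]])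
  have "(\<lambda>n. g (x n + sqrt (s n) *\<^sub>R z)) \<longlonglongrightarrow> g (x' + sqrt s' *\<^sub>R z)" for z
    by (rule continuous_on_tendsto_compose[OF g(1)]) (intro tendsto_intros lim, auto)
  then have "(\<lambda>n. ?f n z) \<longlonglongrightarrow> ennreal (g (x' + sqrt s' *\<^sub>R z) * gauss z 1)" for z
    by (intro tendsto_ennrealI tendsto_mult_right)
  then have "ennreal (g (x' + sqrt s' *\<^sub>R z) * gauss z 1) = liminf (\<lambda>n. ?f n z)" for z
    by (intro lim_imp_Liminf[symmetric] trivial_limit_sequentially)
  then have "(\<integral>\<^sup>+z. ennreal (g (x' + sqrt s' *\<^sub>R z) * gauss z 1) \<partial>lborel) = (\<integral>\<^sup>+z. liminf (\<lambda>n. ?f n z) \<partial>lborel)"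
    by simp
  \<comment> \<open>Fatou's lemma asks for no common majorant. Integrability along the sequence
    matters: without it the Bochner integral would default to 0 and the bound by c would carry no
    information.\<close>
  also have "\<dots> \<le> liminf (\<lambda>n. \<integral>\<^sup>+z. ?f n z \<partial>lborel)"
    by (rule nn_integral_liminf) auto
  also have "\<dots> \<le> ennreal c"
  proof (rule Liminf_le)
    show "\<forall>\<^sub>F n in sequentially. (\<integral>\<^sup>+z. ?f n z \<partial>lborel) \<le> ennreal c"
      using le int g by (intro always_eventually allI) (subst nn_integral_eq_integral, auto simp: heat_def EZ_def c intro!: ennreal_leI)
  qed simp
  finally show ?thesis
    using c g by (auto simp: heat_def EZ_def integral_eq_nn_integral intro: enn2real_leI)
qed

text \<open>Joint lower semicontinuity in filter form. The time change \<open>h\<close> covers both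
  uses, the elapsed time s and the remaining time \<tau> - s.\<close>

lemma eventually_less_heat:
  fixes g :: "'a::euclidean_space \<Rightarrow> real" and h :: "real \<Rightarrow> real"
  assumes g: "continuous_on UNIV g" "\<And>x. g x \<ge> 0" and h: "isCont h (fst w)"
    and int: "\<And>s x. (s, x) \<in> S \<Longrightarrow> integrable lborel (\<lambda>z. g (x + sqrt (h s) *\<^sub>R z) * gauss z 1)"
    and less: "c < heat g (h (fst w)) (snd w)"
  shows "eventually (\<lambda>v. c < heat g (h (fst v)) (snd v)) (at w within S)"
proof (rule sequentially_imp_eventually_within, intro allI impI, rule ccontr)
  fix f assume f: "(\<forall>n. f n \<in> S \<and> f n \<noteq> w) \<and> f \<longlonglongrightarrow> w"
    and ev: "\<not> (\<forall>\<^sub>F n in sequentially. c < heat g (h (fst (f n))) (snd (f n)))"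
  from not_eventually_sequentiallyD[OF ev] obtain r :: "nat \<Rightarrow> nat"
    where r: "strict_mono r" "\<And>n. heat g (h (fst (f (r n)))) (snd (f (r n))) \<le> c"
    by (auto simp: not_less)
  have lim: "(\<lambda>n. f (r n)) \<longlonglongrightarrow> w"
    using f r(1) LIMSEQ_subseq_LIMSEQ[of f w r] by (simp add: o_def)
  have "heat g (h (fst w)) (snd w) \<le> c"
  proof (rule heat_le_sequentially[OF g, where s="\<lambda>n. h (fst (f (r n)))" and x="\<lambda>n. snd (f (r n))"])
    show "integrable lborel (\<lambda>z. g (snd (f (r n)) + sqrt (h (fst (f (r n)))) *\<^sub>R z) * gauss z 1)" for n
      using f by (intro int) auto
    show "(\<lambda>n. h (fst (f (r n)))) \<longlonglongrightarrow> h (fst w)"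
      by (rule isCont_tendsto_compose[OF h tendsto_fst[OF lim]])
  qed (use r lim in \<open>auto intro: tendsto_snd\<close>)
  with less show False by simp
qed

text \<open>Without a maximiser, the relatively open sets on which \<open>D\<close> stays below one
  of its own values cover \<open>S\<close>. In a finite subcover, the point that belongs to the
  largest of these values lies in none of the sets.\<close>

lemma upper_semicontinuous_attains_sup:
  fixes D :: "'a::topological_space \<Rightarrow> real"
  assumes S: "compact S" "S \<noteq> {}"
    and usc: "\<And>x c. x \<in> S \<Longrightarrow> D x < c \<Longrightarrow> eventually (\<lambda>y. D y < c) (at x within S)"
  shows "\<exists>x\<in>S. \<forall>y\<in>S. D y \<le> D x"
proof (rule ccontr)
  assume "\<not> ?thesis"
  then have ex: "\<exists>y\<in>S. D x < D y" if "x \<in> S" for x using that by (auto simp: not_le)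
  define U where "U y = {x\<in>S. D x < D y}" for y
  have op: "openin (top_of_set S) (U y)" for y
  proof (subst openin_subopen, intro ballI)
    fix x assume "x \<in> U y"
    then have x: "x \<in> S" "D x < D y" by (auto simp: U_def)
    from usc[OF this] obtain T where "open T" "x \<in> T" "\<And>v. v \<in> T \<Longrightarrow> v \<noteq> x \<Longrightarrow> v \<in> S \<Longrightarrow> D v < D y"
      unfolding eventually_at_topological by blast
    then show "\<exists>T. openin (top_of_set S) T \<and> x \<in> T \<and> T \<subseteq> U y"
      using x by (intro exI[of _ "S \<inter> T"]) (auto simp: U_def openin_open)
  qed
  have "S \<subseteq> \<Union>(U ` S)" using ex by (force simp: U_def)
  with S(1) op obtain \<C> where \<C>: "\<C> \<subseteq> U ` S" "finite \<C>" "S \<subseteq> \<Union>\<C>"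
    unfolding compact_eq_openin_cover by (metis (no_types, lifting) imageE)
  then obtain Y where Y: "finite Y" "Y \<subseteq> S" "\<C> = U ` Y" by (meson finite_subset_image)
  have "Y \<noteq> {}" using \<C> Y S by auto
  then have "Max (D ` Y) \<in> D ` Y" using Y by (intro Max_in) auto
  then obtain y where "y \<in> Y" and eq: "Max (D ` Y) = D y" by blast
  have y: "D v \<le> D y" if "v \<in> Y" for v
    unfolding eq[symmetric] using that Y by (intro Max_ge) auto
  obtain v where "v \<in> Y" "y \<in> U v" using \<C>(3) Y \<open>y \<in> Y\<close> by auto
  then show False using y[of v] by (auto simp: U_def)
qed

section \<open>Second-order conditions and derivatives along the basis\<close>

lemma second_derivative_nonneg_at_min:
  fixes g g' :: "real \<Rightarrow> real"
  assumes "e > 0" and min: "\<And>r. \<bar>r\<bar> < e \<Longrightarrow> g 0 \<le> g r"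
    and g': "\<And>r. (g has_real_derivative g' r) (at r)" and g'': "(g' has_real_derivative D) (at 0)"
  shows "D \<ge> 0"
proof (rule ccontr)
  assume "\<not> D \<ge> 0"
  then have "D < 0" by simp
  have "g' 0 = 0"
    by (rule DERIV_local_min[OF g' \<open>e > 0\<close>]) (use min in auto)
  with DERIV_neg_dec_right[OF g'' \<open>D < 0\<close>] obtain d where d: "d > 0" "\<And>h. 0 < h \<Longrightarrow> h < d \<Longrightarrow> g' h < 0"
    by auto
  define h where "h = min e d / 2"
  have h: "0 < h" "h < e" "h < d" using \<open>e > 0\<close> d by (auto simp: h_def)
  have "g h < g 0"
  proof (rule DERIV_neg_imp_decreasing_open[OF h(1)])
    show "\<exists>y. (g has_real_derivative y) (at x) \<and> y < 0" if "0 < x" "x < h" for x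
      using g'[of x] d(2)[of x] that h by auto
    show "continuous_on {0..h} g" using g' by (intro DERIV_continuous_on) (auto intro: DERIV_subset)
  qed
  with min[of h] h show False by simp
qed

text \<open>The \<open>laplacian\<close> sees only repeated derivatives along basis vectors, so only
  these are recorded, with neither mixed derivatives nor continuity. \<open>C2\<close> functions,
  heat integrals, their powers and Gaussians all fit in.\<close>

definition has_basis_derivatives ::
    "('a::euclidean_space \<Rightarrow> real) \<Rightarrow> ('a \<Rightarrow> 'a \<Rightarrow> real) \<Rightarrow> ('a \<Rightarrow> 'a \<Rightarrow> real) \<Rightarrow> bool" where
  "has_basis_derivatives f f1 f2 \<longleftrightarrow> (\<forall>b\<in>Basis. \<forall>x.
     ((\<lambda>r. f (x + r *\<^sub>R b)) has_real_derivative f1 b x) (at 0) \<and>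
     ((\<lambda>r. f1 b (x + r *\<^sub>R b)) has_real_derivative f2 b x) (at 0))"

lemma has_basis_derivatives_shift:
  assumes "has_basis_derivatives f f1 f2" "b \<in> Basis"
  shows "((\<lambda>r. f (x + r *\<^sub>R b)) has_real_derivative f1 b (x + r0 *\<^sub>R b)) (at r0)"
proof -
  have "((\<lambda>r. f (x + r0 *\<^sub>R b + r *\<^sub>R b)) has_real_derivative f1 b (x + r0 *\<^sub>R b)) (at 0)"
    using assms by (auto simp: has_basis_derivatives_def)
  then show ?thesis
    using DERIV_shift[of "\<lambda>r. f (x + r *\<^sub>R b)" "f1 b (x + r0 *\<^sub>R b)" 0 r0]
    by (simp add: scaleR_add_left add_ac)
qed

lemma laplacian_eq_sum:
  assumes "has_basis_derivatives f f1 f2"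
  shows "laplacian f x = (\<Sum>b\<in>Basis. f2 b x)"
  unfolding laplacian_def
proof (rule sum.cong[OF refl])
  fix b :: 'a assume b: "b \<in> Basis"
  have "deriv (\<lambda>t. f (x + t *\<^sub>R b)) s = f1 b (x + s *\<^sub>R b)" for s
    by (rule DERIV_imp_deriv[OF has_basis_derivatives_shift[OF assms b]])
  then show "deriv (\<lambda>s. deriv (\<lambda>t. f (x + t *\<^sub>R b)) s) 0 = f2 b x"
    using assms b by (auto simp: has_basis_derivatives_def intro!: DERIV_imp_deriv)
qed

lemma C2_imp_has_basis_derivatives:
  assumes "C2 f"
  obtains f1 f2 where "has_basis_derivatives f f1 f2"
proof -
  from assms obtain F' F'' where F: "\<And>x. (f has_derivative blinfun_apply (F' x)) (at x)"
    "\<And>x. (F' has_derivative blinfun_apply (F'' x)) (at x)" by (auto simp: C2_def)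
  have *: "((\<lambda>r. x + r *\<^sub>R b) has_derivative (\<lambda>r. r *\<^sub>R b)) (at 0)" for x b :: 'a
    by (auto intro!: derivative_eq_intros)
  have "has_basis_derivatives f (\<lambda>b x. F' x b) (\<lambda>b x. F'' x b b)"
    unfolding has_basis_derivatives_def
  proof (intro ballI allI conjI)
    fix b x :: 'a
    have "((\<lambda>r. f (x + r *\<^sub>R b)) has_derivative (\<lambda>r. F' x (r *\<^sub>R b))) (at 0)"
      using has_derivative_compose[OF *[of x b], of f "blinfun_apply (F' x)"] F(1)[of x] by simp
    then show "((\<lambda>r. f (x + r *\<^sub>R b)) has_real_derivative F' x b) (at 0)"
      by (simp add: has_field_derivative_def blinfun.scaleR_right mult.commute[of _ "F' x b"])
    have "((\<lambda>r. F' (x + r *\<^sub>R b)) has_derivative (\<lambda>r. F'' x (r *\<^sub>R b))) (at 0)"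
      using has_derivative_compose[OF *[of x b], of F' "blinfun_apply (F'' x)"] F(2)[of x] by simp
    then have "((\<lambda>r. F' (x + r *\<^sub>R b) b) has_derivative (\<lambda>r. F'' x (r *\<^sub>R b) b)) (at 0)"
      by (auto intro!: derivative_eq_intros)
    then show "((\<lambda>r. F' (x + r *\<^sub>R b) b) has_real_derivative F'' x b b) (at 0)"
      by (simp add: has_field_derivative_def blinfun.scaleR_right blinfun.scaleR_left mult.commute[of _ "F'' x b b"])
  qed
  then show ?thesis by (rule that)
qed

lemma C2_imp_continuous: "C2 f \<Longrightarrow> continuous_on UNIV f"
  by (meson C2_def has_derivative_continuous continuous_at_imp_continuous_on)

text \<open>The second derivative is factored so that inside the bracket the exponent appears only
  as the weight \<open>a - 1\<close> of the gradient term; different powers can then be compared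
  through the same two sums.\<close>

lemma has_basis_derivatives_powr:
  assumes f: "has_basis_derivatives f f1 f2" and pos: "\<And>x. f x > 0"
  shows "has_basis_derivatives (\<lambda>x. f x powr a) (\<lambda>b x. a * f x powr (a - 1) * f1 b x)
           (\<lambda>b x. a * f x powr (a - 1) * (f2 b x + (a - 1) * (f1 b x)\<^sup>2 / f x))"
  unfolding has_basis_derivatives_def
proof (intro ballI allI conjI)
  fix b x :: 'a assume b: "b \<in> Basis"
  have d: "((\<lambda>r. f (x + r *\<^sub>R b)) has_real_derivative f1 b x) (at 0)"
       "((\<lambda>r. f1 b (x + r *\<^sub>R b)) has_real_derivative f2 b x) (at 0)"
    using f b by (auto simp: has_basis_derivatives_def)
  show "((\<lambda>r. f (x + r *\<^sub>R b) powr a) has_real_derivative a * f x powr (a - 1) * f1 b x) (at 0)"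
    using DERIV_fun_powr[OF d(1), of a] pos[of x] by simp
  have "((\<lambda>r. f (x + r *\<^sub>R b) powr (a - 1)) has_real_derivative (a - 1) * f x powr (a - 1 - 1) * f1 b x) (at 0)"
    using DERIV_fun_powr[OF d(1), of "a - 1"] pos[of x] by simp
  moreover have "f x powr (a - 1 - 1) = f x powr (a - 1) / f x"
    using pos[of x] by (subst powr_diff) (simp add: less_imp_neq)
  ultimately have "((\<lambda>r. a * f (x + r *\<^sub>R b) powr (a - 1)) has_real_derivative
      a * ((a - 1) * (f x powr (a - 1) / f x) * f1 b x)) (at 0)"
    by (intro DERIV_cmult) simp
  from DERIV_mult[OF this d(2)]
  show "((\<lambda>r. a * f (x + r *\<^sub>R b) powr (a - 1) * f1 b (x + r *\<^sub>R b)) has_real_derivative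
     a * f x powr (a - 1) * (f2 b x + (a - 1) * (f1 b x)\<^sup>2 / f x)) (at 0)"
    by (rule DERIV_cong) (use pos[of x] in \<open>simp add: distrib_left power2_eq_square mult_ac\<close>)
qed

lemma has_basis_derivatives_exp_norm:
  "has_basis_derivatives (\<lambda>x. exp (A * (norm x)\<^sup>2 + B)) (\<lambda>b x. exp (A * (norm x)\<^sup>2 + B) * (2 * A * (x \<bullet> b)))
     (\<lambda>b x. exp (A * (norm x)\<^sup>2 + B) * (2 * A + 4 * A\<^sup>2 * (x \<bullet> b)\<^sup>2))"
  unfolding has_basis_derivatives_def power2_norm_eq_inner
proof (intro ballI allI conjI)
  fix b x :: 'a assume b: "b \<in> Basis"
  have d: "((\<lambda>r. exp (A * ((x + r *\<^sub>R b) \<bullet> (x + r *\<^sub>R b)) + B)) has_real_derivative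
        exp (A * (x \<bullet> x) + B) * (2 * A * (x \<bullet> b))) (at 0)"
    unfolding inner_add_left inner_add_right inner_scaleR_left inner_scaleR_right
    by (auto intro!: derivative_eq_intros simp: inner_commute)
  then show "((\<lambda>r. exp (A * ((x + r *\<^sub>R b) \<bullet> (x + r *\<^sub>R b)) + B)) has_real_derivative
        exp (A * (x \<bullet> x) + B) * (2 * A * (x \<bullet> b))) (at 0)" .
  have "((\<lambda>r. 2 * A * ((x + r *\<^sub>R b) \<bullet> b)) has_real_derivative 2 * A) (at 0)"
    unfolding inner_add_left inner_scaleR_left
    using b by (auto intro!: derivative_eq_intros)
  from DERIV_mult[OF d this]
  show "((\<lambda>r. exp (A * ((x + r *\<^sub>R b) \<bullet> (x + r *\<^sub>R b)) + B) * (2 * A * ((x + r *\<^sub>R b) \<bullet> b))) has_real_derivative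
        exp (A * (x \<bullet> x) + B) * (2 * A + 4 * A\<^sup>2 * (x \<bullet> b)\<^sup>2)) (at 0)"
    by (rule DERIV_cong) (simp add: algebra_simps power2_eq_square)
qed

lemma has_basis_derivatives_diff:
  assumes "has_basis_derivatives f f1 f2" "has_basis_derivatives g g1 g2"
  shows "has_basis_derivatives (\<lambda>x. f x - g x) (\<lambda>b x. f1 b x - g1 b x) (\<lambda>b x. f2 b x - g2 b x)"
  using assms by (auto simp: has_basis_derivatives_def intro!: DERIV_diff)

lemma has_basis_derivatives_cmult:
  assumes "has_basis_derivatives f f1 f2"
  shows "has_basis_derivatives (\<lambda>x. c * f x) (\<lambda>b x. c * f1 b x) (\<lambda>b x. c * f2 b x)"
  using assms by (auto simp: has_basis_derivatives_def intro!: DERIV_cmult)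

lemma basis_derivative2_nonneg_at_min:
  fixes f :: "'a::euclidean_space \<Rightarrow> real"
  assumes f: "has_basis_derivatives f f1 f2" and b: "b \<in> Basis" and "e > 0"
    and min: "\<And>y. y \<in> ball x e \<Longrightarrow> f x \<le> f y"
  shows "f2 b x \<ge> 0"
proof (rule second_derivative_nonneg_at_min[OF \<open>e > 0\<close>])
  show "((\<lambda>r. f (x + r *\<^sub>R b)) has_real_derivative f1 b (x + r *\<^sub>R b)) (at r)" for r
    by (rule has_basis_derivatives_shift[OF f b])
  show "((\<lambda>r. f1 b (x + r *\<^sub>R b)) has_real_derivative f2 b x) (at 0)"
    using f b by (auto simp: has_basis_derivatives_def)
  show "f (x + 0 *\<^sub>R b) \<le> f (x + r *\<^sub>R b)" if "\<bar>r\<bar> < e" for r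
    using min[of "x + r *\<^sub>R b"] that b by (simp add: dist_norm)
qed

text \<open>Outside the ball of radius \<open>R\<close> the Gaussian is strictly subharmonic, so
  \<open>f\<close> minus c times the Gaussian has no interior minimum on an annulus. On the inner
  sphere this difference is nonnegative; on the outer one positivity of \<open>f\<close> bounds it
  below by a negative quantity that tends to 0 with growing radius.\<close>

lemma superharmonic_gaussian_lower_bound:
  fixes f :: "'a::euclidean_space \<Rightarrow> real"
  assumes C2: "C2 f" and lap: "\<And>x. laplacian f x \<le> 0" and pos: "\<And>x. f x > 0"
    and "\<delta> > 0" "R > 0" and R: "real DIM('a) < 2 * \<delta> * R\<^sup>2"
    and "c > 0" and c: "\<And>x. norm x \<le> R \<Longrightarrow> c \<le> f x"
  shows "c * exp (- \<delta> * (norm x)\<^sup>2) \<le> f x"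
proof (cases "norm x \<le> R")
  case True
  have "c * exp (- \<delta> * (norm x)\<^sup>2) \<le> c * 1"
    using \<open>c > 0\<close> \<open>\<delta> > 0\<close> by (intro mult_left_mono) auto
  with c[OF True] show ?thesis by simp
next
  case False
  \<comment> \<open>The summand 0 is the constant \<open>B\<close> of the general exponential, kept
    so that its derivative formulas apply verbatim.\<close>
  let ?e = "\<lambda>x::'a. exp (- \<delta> * (norm x)\<^sup>2 + 0)"
  obtain f1 f2 where f: "has_basis_derivatives f f1 f2" using C2_imp_has_basis_derivatives[OF C2] .
  let ?h = "\<lambda>x. f x - c * ?e x"
  note h = has_basis_derivatives_diff[OF f has_basis_derivatives_cmult[OF has_basis_derivatives_exp_norm[of "-\<delta>" 0], of c]]
  have bound: "- c * exp (- \<delta> * R'\<^sup>2) \<le> ?h x" if R': "norm x < R'" for R'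
  proof (rule ccontr)
    assume neg: "\<not> - c * exp (- \<delta> * R'\<^sup>2) \<le> ?h x"
    let ?A = "cball 0 R' - ball (0::'a) R"
    have "compact ?A" by (intro compact_diff) auto
    moreover have "x \<in> ?A" using False R' by auto
    moreover have "continuous_on ?A ?h"
      by (intro continuous_intros continuous_on_subset[OF C2_imp_continuous[OF C2]]) auto
    ultimately obtain w where w: "w \<in> ?A" "\<And>y. y \<in> ?A \<Longrightarrow> ?h w \<le> ?h y"
      using continuous_attains_inf[of ?A ?h] by blast
    have hw: "?h w < - c * exp (- \<delta> * R'\<^sup>2)" using w(2)[OF \<open>x \<in> ?A\<close>] neg by linarith
    have "norm w \<noteq> R'"
    proof
      assume "norm w = R'"
      then have "c * ?e w = c * exp (- \<delta> * R'\<^sup>2)" by (simp only: add_0_right)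
      then show False using hw pos[of w] by linarith
    qed
    moreover have "norm w \<noteq> R"
    proof
      assume "norm w = R"
      moreover have "c * ?e w \<le> c * 1"
        using \<open>c > 0\<close> \<open>\<delta> > 0\<close> by (intro mult_left_mono) auto
      moreover have "0 \<le> c * exp (- \<delta> * R'\<^sup>2)" using \<open>c > 0\<close> by simp
      ultimately show False using c[of w] hw by simp
    qed
    ultimately have nw: "R < norm w" "norm w < R'" using w(1) by auto
    define e where "e = min (norm w - R) (R' - norm w)"
    have e: "e > 0" using nw by (simp add: e_def)
    have ball: "y \<in> ?A" if "y \<in> ball w e" for y
    proof -
      have "norm (w - y) < e" using that by (simp add: dist_norm)
      then show ?thesis using norm_triangle_ineq2[of w y] norm_triangle_ineq3[of w y]
        by (auto simp: e_def)
    qed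
    have "0 \<le> (\<Sum>b\<in>Basis. f2 b w - c * (?e w * (2 * (- \<delta>) + 4 * (- \<delta>)\<^sup>2 * (w \<bullet> b)\<^sup>2)))"
      by (rule sum_nonneg, rule basis_derivative2_nonneg_at_min[OF h _ e]) (use w(2) ball in auto)
    also have "\<dots> = laplacian f w - c * (?e w * (2 * (- \<delta>) * real DIM('a) + 4 * \<delta>\<^sup>2 * (norm w)\<^sup>2))"
      by (simp add: sum_subtractf laplacian_eq_sum[OF f] sum.distrib sum_basis_inner_power2 flip: sum_distrib_left)
    finally have le: "c * (?e w * (2 * (- \<delta>) * real DIM('a) + 4 * \<delta>\<^sup>2 * (norm w)\<^sup>2)) \<le> 0"
      using lap[of w] by simp
    have "2 * \<delta> * R\<^sup>2 \<le> 2 * \<delta> * (norm w)\<^sup>2"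
      using \<open>\<delta> > 0\<close> nw \<open>R > 0\<close> by (intro mult_left_mono power_mono) auto
    then have "2 * \<delta> * real DIM('a) < 2 * \<delta> * (2 * \<delta> * (norm w)\<^sup>2)"
      using R \<open>\<delta> > 0\<close> by (intro mult_strict_left_mono order.strict_trans2[OF R]) simp_all
    then have "0 < 2 * (- \<delta>) * real DIM('a) + 4 * \<delta>\<^sup>2 * (norm w)\<^sup>2" by (simp add: power2_eq_square)
    then have "0 < c * (?e w * (2 * (- \<delta>) * real DIM('a) + 4 * \<delta>\<^sup>2 * (norm w)\<^sup>2))"
      using \<open>c > 0\<close> by (intro mult_pos_pos) auto
    with le show False by simp
  qed
  have "((\<lambda>R'. - c * exp (- \<delta> * R'\<^sup>2)) \<longlongrightarrow> - c * 0) at_top"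
    using \<open>\<delta> > 0\<close> by (intro tendsto_mult tendsto_const) real_asymp
  then have "- c * 0 \<le> ?h x"
    by (rule tendsto_upperbound[OF _ eventually_mono[OF eventually_gt_at_top[of "norm x"]]]) (erule bound, simp)
  then show ?thesis by simp
qed

section \<open>The semigroup: its equation, and limits at both ends of the time interval\<close>

lemma heat_solves_heat_equation:
  fixes g :: "'a::euclidean_space \<Rightarrow> real"
  assumes [measurable]: "g \<in> borel_measurable borel" and nn: "\<And>x. g x \<ge> 0"
    and int: "integrable lborel (\<lambda>z. g (0 + sqrt \<tau> *\<^sub>R z) * gauss z 1)" and s: "0 < s" "s < \<tau>"
  obtains U1 U2 where "has_basis_derivatives (heat g s) U1 U2"
    "\<And>x. ((\<lambda>s. heat g s x) has_real_derivative (\<Sum>b\<in>Basis. U2 b x) / 2) (at s)"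
proof -
  have \<tau>: "\<tau> > 0" using s by simp
  define C where "C = (2 * pi * \<tau>) powr (- real DIM('a) / 2)"
  have C: "C > 0" using \<tau> by (simp add: C_def)
  \<comment> \<open>Up to the factor \<open>C\<close>, integrability at the single time \<tau> and
    the single centre 0 is integrability against the weight that controls all earlier times and all
    centres.\<close>
  have "integrable lborel (\<lambda>y. g y * gauss (y - 0) \<tau>)"
    using nonneg_integrable_integral_gauss_affine(1)[of g \<tau> 0] int nn \<tau> by simp
  then have "integrable lborel (\<lambda>y. inverse C * (g y * gauss (y - 0) \<tau>))" by simp
  moreover have "inverse C * (g y * gauss (y - 0) \<tau>) = g y * exp (- (norm y)\<^sup>2 / (2 * \<tau>))" for y
    unfolding gauss_def C_def[symmetric] using C by simp
  ultimately have "integrable lborel (\<lambda>y. g y * exp (- (norm y)\<^sup>2 / (2 * \<tau>)))" by (simp only:)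
  from heat_equation[OF _ this s] obtain U1 U2 where U:
    "\<And>b x. b \<in> Basis \<Longrightarrow> ((\<lambda>r. \<integral>y. g y * gauss (y - (x + r *\<^sub>R b)) s \<partial>lborel) has_real_derivative U1 b x) (at 0)"
    "\<And>b x. b \<in> Basis \<Longrightarrow> ((\<lambda>r. U1 b (x + r *\<^sub>R b)) has_real_derivative U2 b x) (at 0)"
    "\<And>x. ((\<lambda>s. \<integral>y. g y * gauss (y - x) s \<partial>lborel) has_real_derivative (\<Sum>b\<in>Basis. U2 b x) / 2) (at s)"
    by auto
  show ?thesis
  proof (rule that)
    show "has_basis_derivatives (heat g s) U1 U2"
      using U s nn by (simp add: has_basis_derivatives_def heat_eq_integral_gauss)
    show "((\<lambda>s. heat g s x) has_real_derivative (\<Sum>b\<in>Basis. U2 b x) / 2) (at s)" for x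
      by (rule has_field_derivative_transform_within_open[OF U(3), where S="{0<..}"])
         (use s nn in \<open>auto simp: heat_eq_integral_gauss\<close>)
  qed
qed

text \<open>Expanding the square of x + sqrt s z costs a factor 2, so the rate 1 / (32 \<tau>)
  becomes at most |z|^2 / 16 in the exponent. This is well within the |z|^2 / 4 by which the
  exponents of the variances 1 and 2 differ. \<open>B\<close> may depend on x but not on s.\<close>

lemma heat_kernel_growth_bound:
  fixes g :: "'a::euclidean_space \<Rightarrow> real"
  assumes nn: "\<And>x. g x \<ge> 0" and \<tau>: "\<tau> > 0"
    and g: "\<And>x. g x \<le> C * exp ((norm x)\<^sup>2 / (32 * \<tau>))"
  obtains B where "\<And>s z. 0 \<le> s \<Longrightarrow> s \<le> \<tau> \<Longrightarrow> g (x + sqrt s *\<^sub>R z) * gauss z 1 \<le> B * gauss z 2"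
proof -
  have C: "C \<ge> 0" using order.trans[OF nn g[of 0]] by simp
  define D where "D = (2 * pi) powr (- real DIM('a) / 2) / (4 * pi) powr (- real DIM('a) / 2)"
  have D: "D > 0" by (simp add: D_def)
  show ?thesis
  proof (rule that)
    fix s and z :: 'a assume s: "0 \<le> s" "s \<le> \<tau>"
    have "(norm (x + sqrt s *\<^sub>R z))\<^sup>2 / 2 \<le> (norm x)\<^sup>2 + s * (norm z)\<^sup>2"
      using norm_add_power2_divide_le[of 1 1 x "sqrt s *\<^sub>R z"] s by (simp add: power_mult_distrib)
    also have "\<dots> \<le> (norm x)\<^sup>2 + \<tau> * (norm z)\<^sup>2" using s by (simp add: mult_right_mono)
    finally have "(norm (x + sqrt s *\<^sub>R z))\<^sup>2 / 2 / (16 * \<tau>) \<le> ((norm x)\<^sup>2 + \<tau> * (norm z)\<^sup>2) / (16 * \<tau>)"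
      using \<tau> by (intro divide_right_mono) auto
    also have "\<dots> = (norm x)\<^sup>2 / (16 * \<tau>) + (norm z)\<^sup>2 / 16" using \<tau> by (simp add: field_simps)
    finally have "(norm (x + sqrt s *\<^sub>R z))\<^sup>2 / (32 * \<tau>) \<le> (norm x)\<^sup>2 / (16 * \<tau>) + (norm z)\<^sup>2 / 16" by simp
    with zero_le_power2[of "norm z"] have e: "(norm (x + sqrt s *\<^sub>R z))\<^sup>2 / (32 * \<tau>) + - (norm z)\<^sup>2 / 2
        \<le> (norm x)\<^sup>2 / (16 * \<tau>) + - (norm z)\<^sup>2 / 4" by linarith
    have "g (x + sqrt s *\<^sub>R z) * exp (- (norm z)\<^sup>2 / 2)
        \<le> C * exp ((norm (x + sqrt s *\<^sub>R z))\<^sup>2 / (32 * \<tau>)) * exp (- (norm z)\<^sup>2 / 2)"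
      by (intro mult_right_mono g) auto
    also have "\<dots> = C * exp ((norm (x + sqrt s *\<^sub>R z))\<^sup>2 / (32 * \<tau>) + - (norm z)\<^sup>2 / 2)"
      by (simp only: exp_add mult.assoc)
    also have "\<dots> \<le> C * exp ((norm x)\<^sup>2 / (16 * \<tau>) + - (norm z)\<^sup>2 / 4)"
      using C e by (intro mult_left_mono) auto
    finally have "(2 * pi) powr (- real DIM('a) / 2) * (g (x + sqrt s *\<^sub>R z) * exp (- (norm z)\<^sup>2 / 2))
      \<le> (2 * pi) powr (- real DIM('a) / 2) * (C * exp ((norm x)\<^sup>2 / (16 * \<tau>) + - (norm z)\<^sup>2 / 4))"
      by (intro mult_left_mono) auto
    also have "\<dots> = (C * exp ((norm x)\<^sup>2 / (16 * \<tau>)) * D) * gauss z 2"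
      unfolding exp_add by (simp add: D_def gauss_def)
    finally show "g (x + sqrt s *\<^sub>R z) * gauss z 1 \<le> (C * exp ((norm x)\<^sup>2 / (16 * \<tau>)) * D) * gauss z 2"
      by (simp add: gauss_def mult_ac)
  qed
qed

lemma integrable_gauss_growth:
  fixes g :: "'a::euclidean_space \<Rightarrow> real"
  assumes [measurable]: "g \<in> borel_measurable borel" and nn: "\<And>x. g x \<ge> 0" and \<tau>: "\<tau> > 0"
    and g: "\<And>x. g x \<le> C * exp ((norm x)\<^sup>2 / (32 * \<tau>))" and s: "0 \<le> s" "s \<le> \<tau>"
  shows "integrable lborel (\<lambda>z. g (x + sqrt s *\<^sub>R z) * gauss z 1)"
proof -
  obtain B where B: "\<And>s z. 0 \<le> s \<Longrightarrow> s \<le> \<tau> \<Longrightarrow> g (x + sqrt s *\<^sub>R z) * gauss z 1 \<le> B * gauss z 2"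
    using heat_kernel_growth_bound[of g \<tau> C x] nn \<tau> g by blast
  have "integrable lborel (\<lambda>z. B * gauss (z::'a) 2)" using integrable_gauss[of 2 "0::'a"] by simp
  then show ?thesis
    by (rule Bochner_Integration.integrable_bound)
       (use B[OF s] nn in \<open>auto intro!: AE_I2 intro: order.trans[OF _ abs_ge_self]\<close>)
qed

lemma heat_tendsto_at_end:
  fixes g :: "'a::euclidean_space \<Rightarrow> real"
  assumes cont: "continuous_on UNIV g" and nn: "\<And>x. g x \<ge> 0" and \<tau>: "\<tau> > 0"
    and g: "\<And>x. g x \<le> C * exp ((norm x)\<^sup>2 / (32 * \<tau>))"
    and s: "\<And>n. 0 \<le> s n" "\<And>n. s n \<le> \<tau>" "s \<longlonglongrightarrow> \<tau>"
  shows "(\<lambda>n. heat g (s n) x) \<longlonglongrightarrow> heat g \<tau> x"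
  unfolding heat_def EZ_def
proof -
  have [measurable]: "g \<in> borel_measurable borel" using cont by (intro borel_measurable_continuous_onI)
  obtain B where B: "\<And>s z. 0 \<le> s \<Longrightarrow> s \<le> \<tau> \<Longrightarrow> g (x + sqrt s *\<^sub>R z) * gauss z 1 \<le> B * gauss z 2"
    using heat_kernel_growth_bound[of g \<tau> C x] nn \<tau> g by blast
  show "(\<lambda>n. \<integral>z. g (x + sqrt (s n) *\<^sub>R z) * gauss z 1 \<partial>lborel)
          \<longlonglongrightarrow> (\<integral>z. g (x + sqrt \<tau> *\<^sub>R z) * gauss z 1 \<partial>lborel)"
  proof (rule integral_dominated_convergence[where w="\<lambda>z. B * gauss z 2"])
    show "integrable lborel (\<lambda>z. B * gauss (z::'a) 2)" using integrable_gauss[of 2 "0::'a"] by simp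
    show "AE z in lborel. norm (g (x + sqrt (s n) *\<^sub>R z) * gauss z 1) \<le> B * gauss z 2" for n
      using B[OF s(1,2)] nn by (intro AE_I2) simp
    have "(\<lambda>n. g (x + sqrt (s n) *\<^sub>R z)) \<longlonglongrightarrow> g (x + sqrt \<tau> *\<^sub>R z)" for z
      by (rule continuous_on_tendsto_compose[OF cont]) (intro tendsto_intros s, auto)
    then show "AE z in lborel. (\<lambda>n. g (x + sqrt (s n) *\<^sub>R z) * gauss z 1) \<longlonglongrightarrow> g (x + sqrt \<tau> *\<^sub>R z) * gauss z 1"
      by (intro AE_I2 tendsto_mult_right)
  qed auto
qed

text \<open>No growth bound is assumed for \<open>k\<close>, so the integral is split at the unit
  sphere about u. Inside, \<open>k\<close> is bounded and dominated convergence applies; outside,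
  the kernel at time s is at most \<open>r s\<close> times the kernel at time \<tau>, against which
  \<open>k\<close> is integrable.\<close>

lemma heat_tendsto_at_start:
  fixes k :: "'a::euclidean_space \<Rightarrow> real"
  assumes cont: "continuous_on UNIV k" and nn: "\<And>x. k x \<ge> 0" and \<tau>: "\<tau> > 0"
    and int: "\<And>s x. 0 \<le> s \<Longrightarrow> s \<le> \<tau> \<Longrightarrow> integrable lborel (\<lambda>z. k (x + sqrt s *\<^sub>R z) * gauss z 1)"
    and t: "\<And>n. 0 < t n" "\<And>n. t n \<le> \<tau>" "t \<longlonglongrightarrow> 0"
  shows "(\<lambda>n. heat k (t n) u) \<longlonglongrightarrow> k u"
proof -
  have [measurable]: "k \<in> borel_measurable borel" using cont by (intro borel_measurable_continuous_onI)
  define k1 where "k1 y = k y * indicator (cball u 1) y" for y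
  define k2 where "k2 y = k y * indicator (- cball u 1) y" for y
  have [measurable]: "k1 \<in> borel_measurable borel" "k2 \<in> borel_measurable borel"
    unfolding k1_def k2_def by (auto intro!: borel_measurable_times borel_measurable_indicator)
  have k12: "k1 y \<ge> 0" "k2 y \<ge> 0" "k1 y \<le> k y" "k2 y \<le> k y" "k y = k1 y + k2 y" for y
    using nn[of y] by (auto simp: k1_def k2_def indicator_def)
  have intn: "integrable lborel (\<lambda>z. k (u + sqrt (t n) *\<^sub>R z) * gauss z 1)" for n
    using int t(1,2)[of n] by (simp add: less_imp_le)
  have i1: "integrable lborel (\<lambda>z. k1 (u + sqrt (t n) *\<^sub>R z) * gauss z 1)" for n
    by (rule Bochner_Integration.integrable_bound[OF intn[of n]]) (use k12 nn in \<open>auto intro!: AE_I2 mult_right_mono\<close>)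
  have i2: "integrable lborel (\<lambda>z. k2 (u + sqrt (t n) *\<^sub>R z) * gauss z 1)" for n
    by (rule Bochner_Integration.integrable_bound[OF intn[of n]]) (use k12 nn in \<open>auto intro!: AE_I2 mult_right_mono\<close>)
  have "heat k (t n) u = heat k1 (t n) u + heat k2 (t n) u" for n
    unfolding heat_def EZ_def k12(5) distrib_right by (rule Bochner_Integration.integral_add[OF i1 i2])
  moreover have "(\<lambda>n. heat k1 (t n) u) \<longlonglongrightarrow> k u"
  proof -
    obtain M where M: "\<And>y. y \<in> cball u 1 \<Longrightarrow> k y \<le> M"
      using continuous_attains_sup[OF compact_cball _ continuous_on_subset[OF cont], of u 1]
      by (metis subset_UNIV cball_eq_empty not_one_less_zero)
    have M0: "M \<ge> 0" using M[of u] nn[of u] by simp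
    have k1M: "k1 y \<le> M" for y using M M0 by (auto simp: k1_def indicator_def)
    have "(\<lambda>n. \<integral>z. k1 (u + sqrt (t n) *\<^sub>R z) * gauss z 1 \<partial>lborel) \<longlonglongrightarrow> (\<integral>z. k u * gauss z 1 \<partial>(lborel :: 'a measure))"
    proof (rule integral_dominated_convergence[where w="\<lambda>z. M * gauss z 1"])
      show "integrable lborel (\<lambda>z. M * gauss (z::'a) 1)" using integrable_gauss[of 1 "0::'a"] by simp
      show "AE z in lborel. norm (k1 (u + sqrt (t n) *\<^sub>R z) * gauss z 1) \<le> M * gauss z 1" for n
        by (intro AE_I2) (simp add: k12(1) k1M mult_right_mono)
      have "(\<lambda>n. k1 (u + sqrt (t n) *\<^sub>R z)) \<longlonglongrightarrow> k u" for z
      proof -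
        have lim: "(\<lambda>n. u + sqrt (t n) *\<^sub>R z) \<longlonglongrightarrow> u + sqrt 0 *\<^sub>R z"
          by (intro tendsto_intros t)
        then have "(\<lambda>n. k (u + sqrt (t n) *\<^sub>R z)) \<longlonglongrightarrow> k u"
          using continuous_on_tendsto_compose[OF cont lim] by simp
        moreover have "eventually (\<lambda>n. u + sqrt (t n) *\<^sub>R z \<in> ball u 1) sequentially"
          using lim by (intro topological_tendstoD[OF lim]) auto
        then have "eventually (\<lambda>n. k (u + sqrt (t n) *\<^sub>R z) = k1 (u + sqrt (t n) *\<^sub>R z)) sequentially"
          by eventually_elim (auto simp: k1_def indicator_def)
        ultimately show ?thesis by (rule Lim_transform_eventually)
      qed
      then show "AE z in lborel. (\<lambda>n. k1 (u + sqrt (t n) *\<^sub>R z) * gauss z 1) \<longlonglongrightarrow> k u * gauss z 1"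
        by (intro AE_I2 tendsto_mult_right)
    qed auto
    then show ?thesis using integral_gauss[of 1 "0::'a"] by (simp add: heat_def EZ_def)
  qed
  moreover have "(\<lambda>n. heat k2 (t n) u) \<longlonglongrightarrow> 0"
  proof -
    define d where "d = real DIM('a)"
    define C where "C = (2 * pi * \<tau>) powr (- d / 2)"
    have C: "C > 0" using \<tau> by (simp add: C_def)
    \<comment> \<open>The quotient of the kernels of variances s and \<tau> at distance 1. For s
      \<le> \<tau> this quotient does not increase with the distance, so it bounds the whole far
      part.\<close>
    define r where "r s = (2 * pi * s) powr (- d / 2) * exp (- 1 / (2 * s)) * exp (1 / (2 * \<tau>)) / C" for s
    have r0: "r s \<ge> 0" for s using C by (simp add: r_def)
    have k2i: "integrable lborel (\<lambda>y. k2 y * gauss (y - u) \<tau>)"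
    proof (rule Bochner_Integration.integrable_bound)
      show "integrable lborel (\<lambda>y. k y * gauss (y - u) \<tau>)"
        using nonneg_integrable_integral_gauss_affine(1)[of k \<tau> u] int[of \<tau> u] nn \<tau> by simp
    qed (use k12 nn in \<open>auto intro!: AE_I2 mult_right_mono\<close>)
    define I where "I = (\<integral>y. k2 y * gauss (y - u) \<tau> \<partial>lborel)"
    have le: "heat k2 s u \<le> r s * I" if s: "0 < s" "s \<le> \<tau>" for s
    proof -
      have "k2 y * gauss (y - u) s \<le> r s * (k2 y * gauss (y - u) \<tau>)" for y
      proof (cases "y \<in> cball u 1")
        case True
        then show ?thesis by (simp add: k2_def)
      next
        case False
        define W where "W = (norm (y - u))\<^sup>2"
        have "1 < norm (y - u)" using False by (simp add: dist_norm norm_minus_commute)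
        then have W: "W \<ge> 1" by (simp add: W_def)
        have "1 / (2 * s) - 1 / (2 * \<tau>) \<ge> 0" using s by (simp add: field_simps)
        from mult_right_mono[OF W this]
        have "- W / (2 * s) \<le> - 1 / (2 * s) + 1 / (2 * \<tau>) + - W / (2 * \<tau>)" by (simp add: algebra_simps)
        then have "exp (- W / (2 * s)) \<le> exp (- 1 / (2 * s)) * exp (1 / (2 * \<tau>)) * exp (- W / (2 * \<tau>))"
          by (simp flip: exp_add)
        then have "(2 * pi * s) powr (- d / 2) * exp (- W / (2 * s))
          \<le> (2 * pi * s) powr (- d / 2) * (exp (- 1 / (2 * s)) * exp (1 / (2 * \<tau>)) * exp (- W / (2 * \<tau>)))"
          by (intro mult_left_mono) auto
        also have "\<dots> = r s * (C * exp (- W / (2 * \<tau>)))" using C by (simp add: r_def)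
        finally have "gauss (y - u) s \<le> r s * gauss (y - u) \<tau>"
          by (simp add: gauss_def C_def d_def W_def)
        from mult_left_mono[OF this k12(2)[of y]] show ?thesis by (simp add: mult_ac)
      qed
      then have "(\<integral>y. k2 y * gauss (y - u) s \<partial>lborel) \<le> (\<integral>y. r s * (k2 y * gauss (y - u) \<tau>) \<partial>lborel)"
        using k12 k2i r0 by (intro integral_mono_AE' AE_I2) auto
      then show ?thesis using s k12 by (simp add: heat_eq_integral_gauss I_def)
    qed
    have "filterlim t (at_right 0) sequentially"
      using t(1,3) by (auto simp: filterlim_at less_imp_neq[symmetric] intro!: always_eventually)
    moreover have "((\<lambda>s. r s) \<longlongrightarrow> 0) (at_right 0)"
    proof -
      have "d > 0" by (simp add: d_def)
      then have "((\<lambda>s. (2 * pi * s) powr (- d / 2) * exp (- 1 / (2 * s))) \<longlongrightarrow> 0) (at_right 0)"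
        by real_asymp
      then have "((\<lambda>s. (2 * pi * s) powr (- d / 2) * exp (- 1 / (2 * s)) * (exp (1 / (2 * \<tau>)) / C))
          \<longlongrightarrow> 0 * (exp (1 / (2 * \<tau>)) / C)) (at_right 0)" by (intro tendsto_mult tendsto_const)
      then show ?thesis by (simp add: r_def)
    qed
    ultimately have "(\<lambda>n. r (t n)) \<longlonglongrightarrow> 0" by (rule filterlim_compose[rotated])
    then have "(\<lambda>n. r (t n) * I) \<longlonglongrightarrow> 0 * I" by (intro tendsto_mult tendsto_const)
    then have lim0: "(\<lambda>n. r (t n) * I) \<longlonglongrightarrow> 0" by simp
    show ?thesis
      by (rule tendsto_sandwich[OF _ _ tendsto_const lim0])
         (use le t heat_nonneg[OF k12(2)] in \<open>auto intro!: always_eventually\<close>)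
  qed
  ultimately show ?thesis using tendsto_add[of "\<lambda>n. heat k1 (t n) u" "k u" sequentially "\<lambda>n. heat k2 (t n) u" 0] by simp
qed

section \<open>Comparison for the backward heat equation\<close>

text \<open>The analytic core, free of statistics: \<open>k\<close> stands for
  \<open>m^\<kappa>\<close> and \<tau> for the square of \<xi>. Integrability and regularity include
  the time \<tau>, where the terminal data live; regularity is asked for only after time 0.\<close>

locale superharmonic_heat =
  fixes k :: "'a::euclidean_space \<Rightarrow> real" and \<tau> p :: real
  assumes k_cont: "continuous_on UNIV k" and k_pos: "\<And>x. k x > 0"
    and \<tau>_pos: "\<tau> > 0" and p: "0 < p" "p < 1"
    and k_int: "\<And>s x. 0 \<le> s \<Longrightarrow> s \<le> \<tau> \<Longrightarrow> integrable lborel (\<lambda>z. k (x + sqrt s *\<^sub>R z) * gauss z 1)"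
    and powr_C2: "\<And>s. 0 < s \<Longrightarrow> s \<le> \<tau> \<Longrightarrow> C2 (\<lambda>x. heat k s x powr ((1 - p) / 2))"
    and powr_superharmonic: "\<And>s x. 0 < s \<Longrightarrow> s \<le> \<tau> \<Longrightarrow> laplacian (\<lambda>x. heat k s x powr ((1 - p) / 2)) x \<le> 0"
begin

lemma k_measurable [measurable]: "k \<in> borel_measurable borel"
  using k_cont by (intro borel_measurable_continuous_onI)

lemma heat_k_pos: "0 \<le> s \<Longrightarrow> s \<le> \<tau> \<Longrightarrow> heat k s x > 0"
  by (intro heat_pos k_pos k_int)

text \<open>This is the Gaussian lower bound for a superharmonic function, raised to the power -p /
  a. To make \<open>C\<close> independent of time, the minimum of \<open>heat k\<close> is taken
  over a ball and the whole closed time interval at once; lower semicontinuity guarantees that it is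
  attained, hence positive.\<close>

lemma heat_k_powr_minus_le:
  assumes "\<delta> > 0"
  obtains C where "C > 0" "\<And>s x. 0 < s \<Longrightarrow> s \<le> \<tau> \<Longrightarrow> heat k s x powr (- p) \<le> C * exp (\<delta> * (norm x)\<^sup>2)"
proof -
  define a where "a = (1 - p) / 2"
  have a: "a > 0" using p by (simp add: a_def)
  \<comment> \<open>The power -p / a multiplies the rate by p / a, which brings
    \<open>\<delta>0\<close> back to \<delta>. The radius below makes 2 \<open>\<delta>0\<close> R^2
    twice the dimension.\<close>
  define \<delta>0 where "\<delta>0 = \<delta> * a / p"
  have \<delta>0: "\<delta>0 > 0" using assms a p by (simp add: \<delta>0_def)
  define R where "R = sqrt (real DIM('a) / \<delta>0)"
  have R: "R > 0" "real DIM('a) < 2 * \<delta>0 * R\<^sup>2" using \<delta>0 by (auto simp: R_def)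
  have "\<exists>w\<in>{0..\<tau>} \<times> cball (0::'a) R. \<forall>v\<in>{0..\<tau>} \<times> cball 0 R. - heat k (fst v) (snd v) \<le> - heat k (fst w) (snd w)"
  proof (rule upper_semicontinuous_attains_sup)
    show "compact ({0..\<tau>} \<times> cball (0::'a) R)" by (intro compact_Times) auto
    show "{0..\<tau>} \<times> cball (0::'a) R \<noteq> {}" using \<tau>_pos R by auto
    fix w c assume "w \<in> {0..\<tau>} \<times> cball (0::'a) R" "- heat k (fst w) (snd w) < c"
    then have "eventually (\<lambda>v. - c < heat k (fst v) (snd v)) (at w within {0..\<tau>} \<times> cball 0 R)"
      using k_pos by (intro eventually_less_heat[where h="\<lambda>s. s"] k_cont k_int) (auto intro: less_imp_le)
    then show "eventually (\<lambda>v. - heat k (fst v) (snd v) < c) (at w within {0..\<tau>} \<times> cball 0 R)"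
      by eventually_elim simp
  qed
  then obtain w where w: "w \<in> {0..\<tau>} \<times> cball (0::'a) R"
    "\<And>s x. 0 \<le> s \<Longrightarrow> s \<le> \<tau> \<Longrightarrow> norm x \<le> R \<Longrightarrow> heat k (fst w) (snd w) \<le> heat k s x" by force
  define c where "c = heat k (fst w) (snd w) powr a"
  have hw: "heat k (fst w) (snd w) > 0" using w(1) by (intro heat_k_pos) auto
  have c: "c > 0" using hw by (simp add: c_def)
  show ?thesis
  proof (rule that)
    show "c powr (- p / a) > 0" using c by simp
    fix s and x :: 'a assume s: "0 < s" "s \<le> \<tau>"
    have h: "heat k s y > 0" for y using heat_k_pos s by simp
    have "c * exp (- \<delta>0 * (norm x)\<^sup>2) \<le> heat k s x powr a"
    proof (rule superharmonic_gaussian_lower_bound[OF _ _ _ \<delta>0 R c])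
      show "C2 (\<lambda>x. heat k s x powr a)" "\<And>x. laplacian (\<lambda>x. heat k s x powr a) x \<le> 0"
        using powr_C2 powr_superharmonic s by (auto simp: a_def)
      show "heat k s x powr a > 0" for x using h[of x] by simp
      show "c \<le> heat k s x powr a" if "norm x \<le> R" for x
        unfolding c_def using a s w(2)[of s x] hw that by (intro powr_mono2) auto
    qed
    then have "(heat k s x powr a) powr (- p / a) \<le> (c * exp (- \<delta>0 * (norm x)\<^sup>2)) powr (- p / a)"
      using c a p by (intro powr_mono2') (auto simp: divide_nonpos_pos)
    moreover have "(heat k s x powr a) powr (- p / a) = heat k s x powr (- p)"
      using a by (simp add: powr_powr)
    moreover have "(c * exp (- \<delta>0 * (norm x)\<^sup>2)) powr (- p / a) = c powr (- p / a) * exp (\<delta> * (norm x)\<^sup>2)"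
      using c a p by (simp add: powr_mult exp_powr_real \<delta>0_def)
    ultimately show "heat k s x powr (- p) \<le> c powr (- p / a) * exp (\<delta> * (norm x)\<^sup>2)" by simp
  qed
qed

section \<open>Terminal data and barrier\<close>

definition g :: "'a \<Rightarrow> real" where "g x = heat k \<tau> x powr (- p)"

lemma g_pos: "g x > 0"
  using heat_k_pos[of \<tau> x] \<tau>_pos by (simp add: g_def)

text \<open>The heat equation gives regularity only before time \<tau>. At \<tau> itself continuity
  comes from the assumed \<open>C2\<close> power of \<open>heat k\<close>, of which \<open>g\<close>
  is again a power.\<close>

lemma g_cont: "continuous_on UNIV g"
proof -
  have "continuous_on UNIV (\<lambda>x. (heat k \<tau> x powr ((1 - p) / 2)) powr (- 2 * p / (1 - p)))"
    using heat_k_pos[of \<tau>] \<tau>_pos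
    by (intro continuous_on_powr C2_imp_continuous powr_C2 continuous_on_const) (auto simp: less_le)
  moreover have "(heat k \<tau> x powr ((1 - p) / 2)) powr (- 2 * p / (1 - p)) = g x" for x
    using p by (simp add: g_def powr_powr)
  ultimately show ?thesis by simp
qed

lemma g_measurable [measurable]: "g \<in> borel_measurable borel"
  using g_cont by (intro borel_measurable_continuous_onI)

lemma g_growth: obtains C where "\<And>x. g x \<le> C * exp ((norm x)\<^sup>2 / (32 * \<tau>))"
proof -
  obtain C where "\<And>s x. 0 < s \<Longrightarrow> s \<le> \<tau> \<Longrightarrow> heat k s x powr (- p) \<le> C * exp (1 / (32 * \<tau>) * (norm x)\<^sup>2)"
    by (rule heat_k_powr_minus_le[of "1 / (32 * \<tau>)"]) (use \<tau>_pos in auto)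
  from that[of C] this[of \<tau>] \<tau>_pos show ?thesis by (simp add: g_def)
qed

lemma g_int:
  assumes "0 \<le> s" "s \<le> \<tau>"
  shows "integrable lborel (\<lambda>z. g (x + sqrt s *\<^sub>R z) * gauss z 1)"
proof -
  obtain C where "\<And>x. g x \<le> C * exp ((norm x)\<^sup>2 / (32 * \<tau>))" using g_growth by blast
  then show ?thesis
    using assms \<tau>_pos g_pos by (intro integrable_gauss_growth[of g \<tau> C]) (auto intro: less_imp_le)
qed

text \<open>The coefficient of \<open>|x|\<^sup>2\<close> must decrease in \<open>t\<close> fast enough to absorb the quadratic term
  of the Laplacian, yet exceed \<open>1 / (32 \<tau>)\<close>, the growth rate allowed for the functions compared.\<close>

definition barrier :: "real \<Rightarrow> 'a \<Rightarrow> real" where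
  "barrier t x = exp (1 / (16 * \<tau>) * (1 + (\<tau> - t) / \<tau>) * (norm x)\<^sup>2 + (real DIM('a) / (8 * \<tau>) + 1) * (\<tau> - t))"

text \<open>Relative to the barrier, half the Laplacian contributes A d + 2 A^2 |x|^2 and the time
  derivative -|x|^2 / (16 \<tau>^2) - d / (8 \<tau>) - 1. Since A \<le> 1 / (8 \<tau>), both
  positive terms are absorbed, and the summand 1 makes the inequality strict.\<close>

lemma barrier_strictly_supercaloric:
  fixes x :: 'a
  assumes "0 < t" "t \<le> \<tau>"
  obtains \<Psi>t \<Psi>1 \<Psi>2 where "has_basis_derivatives (barrier t) \<Psi>1 \<Psi>2"
    "((\<lambda>t. barrier t x) has_real_derivative \<Psi>t) (at t)"
    "\<Psi>t + (\<Sum>b\<in>Basis. \<Psi>2 b x) / 2 < 0"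
proof -
  define d where "d = real DIM('a)"
  define A where "A = 1 / (16 * \<tau>) * (1 + (\<tau> - t) / \<tau>)"
  define B where "B = (d / (8 * \<tau>) + 1) * (\<tau> - t)"
  define X where "X = (norm x)\<^sup>2"
  have A: "0 \<le> A" "A \<le> 1 / (8 * \<tau>)"
    using assms \<tau>_pos by (auto simp: A_def field_simps)
  have b: "barrier t = (\<lambda>x. exp (A * (norm x)\<^sup>2 + B))"
    by (auto simp: barrier_def A_def B_def d_def)
  show ?thesis
  proof (rule that)
    show "has_basis_derivatives (barrier t) (\<lambda>b x. exp (A * (norm x)\<^sup>2 + B) * (2 * A * (x \<bullet> b)))
     (\<lambda>b x. exp (A * (norm x)\<^sup>2 + B) * (2 * A + 4 * A\<^sup>2 * (x \<bullet> b)\<^sup>2))"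
      unfolding b by (rule has_basis_derivatives_exp_norm)
    show "((\<lambda>t. barrier t x) has_real_derivative
        exp (A * X + B) * (- X / (16 * \<tau>\<^sup>2) - (d / (8 * \<tau>) + 1))) (at t)"
      unfolding barrier_def A_def B_def d_def[symmetric] X_def[symmetric] using \<tau>_pos
      by (auto intro!: derivative_eq_intros simp: power2_eq_square)
    have "(\<Sum>b\<in>Basis. exp (A * (norm x)\<^sup>2 + B) * (2 * A + 4 * A\<^sup>2 * (x \<bullet> b)\<^sup>2))
        = exp (A * X + B) * (2 * A * d + 4 * A\<^sup>2 * X)"
      by (simp add: sum.distrib sum_basis_inner_power2 X_def d_def flip: sum_distrib_left)
    then have "exp (A * X + B) * (- X / (16 * \<tau>\<^sup>2) - (d / (8 * \<tau>) + 1)) +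
        (\<Sum>b\<in>Basis. exp (A * (norm x)\<^sup>2 + B) * (2 * A + 4 * A\<^sup>2 * (x \<bullet> b)\<^sup>2)) / 2
       = exp (A * X + B) * ((A * d - d / (8 * \<tau>)) + (2 * A\<^sup>2 * X - X / (16 * \<tau>\<^sup>2)) - 1)"
      by (simp add: algebra_simps)
    also have "\<dots> < 0"
    proof -
      have "A * d \<le> 1 / (8 * \<tau>) * d" using A by (intro mult_right_mono) (auto simp: d_def)
      moreover have "2 * A\<^sup>2 * X \<le> 2 * (1 / (8 * \<tau>))\<^sup>2 * X"
        using A by (intro mult_right_mono mult_left_mono power_mono) (auto simp: X_def)
      moreover have "2 * (1 / (8 * \<tau>))\<^sup>2 * X \<le> X / (16 * \<tau>\<^sup>2)"
        using \<tau>_pos by (simp add: X_def field_simps power2_eq_square)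
      ultimately have "(A * d - d / (8 * \<tau>)) + (2 * A\<^sup>2 * X - X / (16 * \<tau>\<^sup>2)) - 1 < 0" by simp
      then show ?thesis by (simp add: mult_less_0_iff)
    qed
    finally show "exp (A * X + B) * (- X / (16 * \<tau>\<^sup>2) - (d / (8 * \<tau>) + 1)) +
        (\<Sum>b\<in>Basis. exp (A * (norm x)\<^sup>2 + B) * (2 * A + 4 * A\<^sup>2 * (x \<bullet> b)\<^sup>2)) / 2 < 0" .
  qed
qed

lemma barrier_ge: "0 < t \<Longrightarrow> t \<le> \<tau> \<Longrightarrow> exp ((norm x)\<^sup>2 / (16 * \<tau>)) \<le> barrier t x"
proof -
  assume t: "0 < t" "t \<le> \<tau>"
  have "(norm x)\<^sup>2 / (16 * \<tau>) * 1 \<le> (norm x)\<^sup>2 / (16 * \<tau>) * (1 + (\<tau> - t) / \<tau>)"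
    using t by (intro mult_left_mono) auto
  moreover have "0 \<le> (real DIM('a) / (8 * \<tau>) + 1) * (\<tau> - t)" using t by auto
  ultimately have "(norm x)\<^sup>2 / (16 * \<tau>) \<le> (norm x)\<^sup>2 / (16 * \<tau>) * (1 + (\<tau> - t) / \<tau>) + (real DIM('a) / (8 * \<tau>) + 1) * (\<tau> - t)"
    by linarith
  then show ?thesis by (simp add: barrier_def mult_ac)
qed

text \<open>Let S be the Laplacian of \<open>heat k t\<close> and Q its squared gradient divided by
  its value. For the power -p, time contributes S / 2 and space (S - (p + 1) Q) / 2 to the bracket,
  in total S - (p + 1) Q / 2, with a negative factor in front. For the power a the bracket is S + (a
  - 1) Q, with a positive factor when a > 0. The brackets agree exactly for a = (1 - p) / 2.\<close>

lemma heat_k_powr_minus_subcaloric: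
  fixes x :: 'a
  assumes t: "0 < t" "t < \<tau>"
  obtains Gt G1 G2 where "has_basis_derivatives (\<lambda>x. heat k t x powr (- p)) G1 G2"
    "((\<lambda>t. heat k t x powr (- p)) has_real_derivative Gt) (at t)"
    "0 \<le> Gt + (\<Sum>b\<in>Basis. G2 b x) / 2"
proof -
  define a where "a = (1 - p) / 2"
  have a: "a > 0" using p by (simp add: a_def)
  have pos: "heat k t y > 0" for y using heat_k_pos[of t y] t by simp
  obtain K1 K2 where K: "has_basis_derivatives (heat k t) K1 K2"
    "\<And>x. ((\<lambda>s. heat k s x) has_real_derivative (\<Sum>b\<in>Basis. K2 b x) / 2) (at t)"
    by (rule heat_solves_heat_equation[OF k_measurable less_imp_le[OF k_pos] k_int[of \<tau> 0] t])
       (use \<tau>_pos in auto)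
  define h where "h = heat k t x"
  have h: "h > 0" using pos by (simp add: h_def)
  define S where "S = (\<Sum>b\<in>Basis. K2 b x)"
  define Q where "Q = (\<Sum>b\<in>Basis. (K1 b x)\<^sup>2 / h)"
  have sum_powr: "(\<Sum>b\<in>Basis. e * h powr (e - 1) * (K2 b x + (e - 1) * (K1 b x)\<^sup>2 / h))
      = e * h powr (e - 1) * (S + (e - 1) * Q)" for e
    by (simp add: S_def Q_def sum.distrib distrib_left sum_distrib_left mult_ac flip: times_divide_eq_right)
  have "laplacian (\<lambda>x. heat k t x powr a) x \<le> 0"
    using powr_superharmonic[of t x] t by (simp add: a_def)
  then have "a * h powr (a - 1) * (S + (a - 1) * Q) \<le> 0"
    using laplacian_eq_sum[OF has_basis_derivatives_powr[OF K(1) pos, of a], of x] sum_powr[of a]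
    by (simp add: h_def)
  then have le: "S + (a - 1) * Q \<le> 0" using a h by (simp add: mult_le_0_iff)
  show ?thesis
  proof (rule that)
    show "has_basis_derivatives (\<lambda>x. heat k t x powr (- p))
        (\<lambda>b x. - p * heat k t x powr (- p - 1) * K1 b x)
        (\<lambda>b x. - p * heat k t x powr (- p - 1) * (K2 b x + (- p - 1) * (K1 b x)\<^sup>2 / heat k t x))"
      by (rule has_basis_derivatives_powr[OF K(1) pos])
    show "((\<lambda>t. heat k t x powr (- p)) has_real_derivative - p * h powr (- p - 1) * (S / 2)) (at t)"
      using DERIV_fun_powr[OF K(2)[of x], of "- p"] h by (simp add: h_def S_def)
    have "- p * h powr (- p - 1) * (S / 2) +
       (\<Sum>b\<in>Basis. - p * heat k t x powr (- p - 1) * (K2 b x + (- p - 1) * (K1 b x)\<^sup>2 / heat k t x)) / 2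
      = - p * h powr (- p - 1) * (S / 2) + (- p * h powr (- p - 1) * (S + (- p - 1) * Q)) / 2"
      unfolding h_def[symmetric] sum_powr[of "- p"] ..
    also have "\<dots> = - (p * h powr (- p - 1) * (S + (a - 1) * Q))"
      by (simp add: a_def field_simps)
    also have "\<dots> \<ge> 0"
      using le p h by (simp add: mult_le_0_iff)
    finally show "0 \<le> - p * h powr (- p - 1) * (S / 2) +
       (\<Sum>b\<in>Basis. - p * heat k t x powr (- p - 1) * (K2 b x + (- p - 1) * (K1 b x)\<^sup>2 / heat k t x)) / 2" .
  qed
qed

text \<open>\<open>heat k\<close> enters decreasingly through the power -p, \<open>heat g\<close>
  through the minus sign, and the barrier is continuous. The slack below c is shared equally among
  the three.\<close>

lemma comparison_upper_semicontinuous: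
  assumes w: "0 < t1" "S \<subseteq> {t1..\<tau>} \<times> UNIV" "w \<in> S"
    and less: "heat k (fst w) (snd w) powr (- p) - heat g (\<tau> - fst w) (snd w) - \<epsilon> * barrier (fst w) (snd w) < c"
  shows "eventually (\<lambda>v. heat k (fst v) (snd v) powr (- p) - heat g (\<tau> - fst v) (snd v)
            - \<epsilon> * barrier (fst v) (snd v) < c) (at w within S)"
proof -
  define G where "G v = heat k (fst v) (snd v) powr (- p)" for v
  define H where "H v = heat g (\<tau> - fst v) (snd v)" for v
  define \<Psi> where "\<Psi> v = \<epsilon> * barrier (fst v) (snd v)" for v
  define e where "e = (c - (G w - H w - \<Psi> w)) / 3"
  have e: "e > 0" using less by (simp add: e_def G_def H_def \<Psi>_def)
  have time: "0 \<le> s" "s \<le> \<tau>" "0 \<le> \<tau> - s" "\<tau> - s \<le> \<tau>" if "(s, x) \<in> S" for s x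
    using that w by auto
  have K: "heat k (fst w) (snd w) > 0" using time[of "fst w" "snd w"] w by (intro heat_k_pos) auto
  have G: "G w > 0" using K by (simp add: G_def)
  \<comment> \<open>The level of \<open>heat k\<close> whose power -p equals \<open>G w + e\<close>;
    staying above it keeps \<open>G\<close> below \<open>G w + e\<close>.\<close>
  define c' where "c' = (G w + e) powr (- 1 / p)"
  have c': "c' > 0" "c' powr (- p) = G w + e" using G e p by (auto simp: c'_def powr_powr)
  have "(G w + e) powr (- 1 / p) < G w powr (- 1 / p)"
    using G e p by (intro powr_less_mono2_neg) auto
  also have "\<dots> = heat k (fst w) (snd w)" using K p by (simp add: G_def powr_powr)
  finally have "eventually (\<lambda>v. c' < heat k (fst v) (snd v)) (at w within S)"
    unfolding c'_def[symmetric] using k_pos time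
    by (intro eventually_less_heat[where h="\<lambda>s. s"] k_cont k_int) (auto intro: less_imp_le)
  then have "eventually (\<lambda>v. G v < G w + e) (at w within S)"
  proof eventually_elim
    case (elim v)
    then have "heat k (fst v) (snd v) powr (- p) < c' powr (- p)"
      using c' p by (intro powr_less_mono2_neg) auto
    then show ?case using c' by (simp add: G_def)
  qed
  moreover have "eventually (\<lambda>v. H w - e < H v) (at w within S)"
    unfolding H_def using g_pos e time
    by (intro eventually_less_heat[where h="\<lambda>s. \<tau> - s"] g_cont g_int) (auto intro: less_imp_le)
  moreover have "eventually (\<lambda>v. \<Psi> w - e < \<Psi> v) (at w within S)"
  proof -
    have "continuous_on UNIV \<Psi>" unfolding \<Psi>_def barrier_def divide_inverse by (intro continuous_intros)
    then have "(\<Psi> \<longlongrightarrow> \<Psi> w) (at w within S)"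
      unfolding continuous_on_def using tendsto_within_subset[of \<Psi> _ w UNIV S] by blast
    then show ?thesis using e by (intro order_tendstoD(1)) auto
  qed
  ultimately have "eventually (\<lambda>v. G v - H v - \<Psi> v < c) (at w within S)"
  proof eventually_elim
    case (elim v)
    then show ?case using e_def by argo
  qed
  then show ?thesis by (simp add: G_def H_def \<Psi>_def)
qed

text \<open>The parabolic maximum principle, run backwards in time from \<open>t = \<tau>\<close>, where both sides agree.\<close>

lemma heat_k_powr_minus_le_heat_g:
  fixes u :: 'a
  assumes t1: "0 < t1" "t1 < \<tau>"
  shows "heat k t1 u powr (- p) \<le> heat g (\<tau> - t1) u"
proof -
  define D where "D \<epsilon> t x = heat k t x powr (- p) - heat g (\<tau> - t) x - \<epsilon> * barrier t x" for \<epsilon> t and x :: 'a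
  \<comment> \<open>The barrier serves twice: it confines the maximum to a ball, and it makes the
    differential inequality at the maximum strict. Letting \<epsilon> tend to 0 removes it at the
    end.\<close>
  have neg: "D \<epsilon> t1 u \<le> 0" if \<epsilon>: "\<epsilon> > 0" for \<epsilon>
  proof (rule ccontr)
    assume "\<not> D \<epsilon> t1 u \<le> 0"
    then have Du: "D \<epsilon> t1 u > 0" by simp
    obtain C where C: "C > 0" "\<And>s x. 0 < s \<Longrightarrow> s \<le> \<tau> \<Longrightarrow> heat k s x powr (- p) \<le> C * exp (1 / (32 * \<tau>) * (norm x)\<^sup>2)"
      using heat_k_powr_minus_le[of "1 / (32 * \<tau>)"] \<tau>_pos by auto
    \<comment> \<open>With y = |x|^2 / (32 \<tau>) the growth bound is C e^y, while the barrier is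
      at least e^(2 y); so \<epsilon> times the barrier wins once y \<ge> C / \<epsilon>. The
      summand \<open>norm u\<close> keeps u inside the ball.\<close>
    define R where "R = norm u + sqrt (32 * \<tau> * C / \<epsilon>)"
    have far: "D \<epsilon> t x < 0" if t: "0 < t" "t \<le> \<tau>" and x: "R \<le> norm x" for t x
    proof -
      define y where "y = (norm x)\<^sup>2 / (32 * \<tau>)"
      have "sqrt (32 * \<tau> * C / \<epsilon>) \<le> norm x" using x by (simp add: R_def add_increasing order.trans[rotated])
      then have "32 * \<tau> * C / \<epsilon> \<le> (norm x)\<^sup>2" by (rule sqrt_le_D)
      then have "C / \<epsilon> \<le> y" using \<tau>_pos \<epsilon> by (simp add: y_def field_simps)
      also have "y < exp y" using exp_ge_add_one_self[of y] by linarith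
      finally have "C < \<epsilon> * exp y" using \<epsilon> by (simp add: field_simps)
      then have "C * exp y < \<epsilon> * exp y * exp y" by simp
      also have "\<dots> = \<epsilon> * exp ((norm x)\<^sup>2 / (16 * \<tau>))" by (simp add: y_def flip: exp_add)
      also have "\<dots> \<le> \<epsilon> * barrier t x" using \<epsilon> barrier_ge[OF t, of x] by simp
      finally have "C * exp y < \<epsilon> * barrier t x" .
      moreover have "heat k t x powr (- p) \<le> C * exp y" using C(2)[OF t, of x] by (simp add: y_def)
      moreover have "heat g (\<tau> - t) x \<ge> 0" using g_pos by (intro heat_nonneg less_imp_le)
      ultimately show ?thesis by (simp add: D_def)
    qed
    define S where "S = {t1..\<tau>} \<times> cball (0::'a) R"
    have uS: "(t1, u) \<in> S" using t1 \<epsilon> C \<tau>_pos by (simp add: S_def R_def)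
    have "\<exists>w\<in>S. \<forall>v\<in>S. D \<epsilon> (fst v) (snd v) \<le> D \<epsilon> (fst w) (snd w)"
    proof (rule upper_semicontinuous_attains_sup)
      show "compact S" unfolding S_def by (intro compact_Times) auto
      show "S \<noteq> {}" using uS by auto
      show "eventually (\<lambda>v. D \<epsilon> (fst v) (snd v) < c) (at w within S)"
        if "w \<in> S" "D \<epsilon> (fst w) (snd w) < c" for w c
        unfolding D_def using that t1
        by (intro comparison_upper_semicontinuous[of t1]) (auto simp: S_def D_def)
    qed
    then obtain t0 x0 where w: "(t0, x0) \<in> S" "\<And>t x. (t, x) \<in> S \<Longrightarrow> D \<epsilon> t x \<le> D \<epsilon> t0 x0" by force
    have D0: "D \<epsilon> t0 x0 > 0" using w(2)[OF uS] Du by linarith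
    have t0: "0 < t0" "t0 \<le> \<tau>" "t1 \<le> t0" using w(1) t1 by (auto simp: S_def)
    \<comment> \<open>At the terminal time the first two terms cancel and only the negative barrier
      term is left. A positive maximum therefore lies strictly earlier, where both heat equations
      hold.\<close>
    have "D \<epsilon> \<tau> x0 < 0"
      using \<epsilon> by (simp add: D_def heat_0 g_def barrier_def)
    then have t0': "t0 < \<tau>" using D0 t0 by (cases "t0 = \<tau>") auto
    have x0: "norm x0 < R" using far[OF t0(1,2), of x0] D0 by force
    obtain Gt G1 G2 where G: "has_basis_derivatives (\<lambda>x. heat k t0 x powr (- p)) G1 G2"
      "((\<lambda>t. heat k t x0 powr (- p)) has_real_derivative Gt) (at t0)"
      "0 \<le> Gt + (\<Sum>b\<in>Basis. G2 b x0) / 2"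
      using heat_k_powr_minus_subcaloric[OF t0(1) t0'] by blast
    obtain \<Psi>t \<Psi>1 \<Psi>2 where \<Psi>: "has_basis_derivatives (barrier t0) \<Psi>1 \<Psi>2"
      "((\<lambda>t. barrier t x0) has_real_derivative \<Psi>t) (at t0)"
      "\<Psi>t + (\<Sum>b\<in>Basis. \<Psi>2 b x0) / 2 < 0"
      using barrier_strictly_supercaloric[OF t0(1,2)] by blast
    obtain H1 H2 where H: "has_basis_derivatives (heat g (\<tau> - t0)) H1 H2"
      "((\<lambda>s. heat g s x0) has_real_derivative (\<Sum>b\<in>Basis. H2 b x0) / 2) (at (\<tau> - t0))"
    proof (rule heat_solves_heat_equation[OF g_measurable less_imp_le[OF g_pos] g_int[of \<tau> 0]])
      show "0 < \<tau> - t0" "\<tau> - t0 < \<tau>" using t0 t0' by auto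
    qed (use \<tau>_pos in auto)
    have min: "- D \<epsilon> t0 x0 \<le> - D \<epsilon> t x" if "t1 \<le> t" "t \<le> \<tau>" "norm x \<le> R" for t x
      using w(2)[of t x] that by (simp add: S_def)
    have space: "0 \<le> \<epsilon> * \<Psi>2 b x0 - (G2 b x0 - H2 b x0)" if b: "b \<in> Basis" for b
    proof (rule basis_derivative2_nonneg_at_min[OF has_basis_derivatives_diff[OF has_basis_derivatives_cmult[OF \<Psi>(1)]
            has_basis_derivatives_diff[OF G(1) H(1)]] b])
      show "0 < R - norm x0" using x0 by simp
      fix y assume "y \<in> ball x0 (R - norm x0)"
      then have "norm y \<le> R" using norm_triangle_ineq2[of y x0] by (simp add: dist_norm norm_minus_commute)
      from min[OF t0(3,2) this]
      show "\<epsilon> * barrier t0 x0 - (heat k t0 x0 powr - p - heat g (\<tau> - t0) x0)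
        \<le> \<epsilon> * barrier t0 y - (heat k t0 y powr - p - heat g (\<tau> - t0) y)" by (simp add: D_def)
    qed
    have "0 \<le> (\<Sum>b\<in>Basis. \<epsilon> * \<Psi>2 b x0 - (G2 b x0 - H2 b x0))" by (intro sum_nonneg space)
    then have space_sum: "0 \<le> \<epsilon> * (\<Sum>b\<in>Basis. \<Psi>2 b x0) - (\<Sum>b\<in>Basis. G2 b x0) + (\<Sum>b\<in>Basis. H2 b x0)"
      by (simp add: sum_subtractf sum_distrib_left)
    have Ht: "((\<lambda>t. heat g (\<tau> - t) x0) has_real_derivative (\<Sum>b\<in>Basis. H2 b x0) / 2 * - 1) (at t0)"
      by (rule DERIV_chain2[where f="\<lambda>s. heat g s x0" and g="\<lambda>t. \<tau> - t", OF H(2)]) (auto intro!: derivative_eq_intros)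
    have Dt: "((\<lambda>t. D \<epsilon> t x0) has_real_derivative Gt + (\<Sum>b\<in>Basis. H2 b x0) / 2 - \<epsilon> * \<Psi>t) (at t0)"
      unfolding D_def using DERIV_diff[OF DERIV_diff[OF G(2) Ht] DERIV_cmult[OF \<Psi>(2), of \<epsilon>]] by simp
    \<comment> \<open>The maximum may sit at t0 = t1, where only later times are available. This
      one-sided comparison is the right one for a backward equation: it bounds the time derivative
      from above, as the maximum in space bounds the Laplacian.\<close>
    have "Gt + (\<Sum>b\<in>Basis. H2 b x0) / 2 - \<epsilon> * \<Psi>t \<le> 0"
    proof (rule ccontr)
      assume "\<not> ?thesis"
      with DERIV_pos_inc_right[OF Dt] obtain d where d: "d > 0" "\<And>h. 0 < h \<Longrightarrow> h < d \<Longrightarrow> D \<epsilon> t0 x0 < D \<epsilon> (t0 + h) x0"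
        by auto
      define h where "h = min d (\<tau> - t0) / 2"
      have h: "0 < h" "h < d" "t0 + h \<le> \<tau>" using d t0' by (auto simp: h_def min_def field_simps)
      show False using d(2)[OF h(1,2)] min[of "t0 + h" x0] h t0 x0 by simp
    qed
    with space_sum have "\<epsilon> * (\<Psi>t + (\<Sum>b\<in>Basis. \<Psi>2 b x0) / 2) \<ge> Gt + (\<Sum>b\<in>Basis. G2 b x0) / 2"
      by (simp add: distrib_left)
    moreover have "\<epsilon> * (\<Psi>t + (\<Sum>b\<in>Basis. \<Psi>2 b x0) / 2) < 0"
      using \<Psi>(3) \<epsilon> by (simp add: mult_pos_neg)
    ultimately show False using G(3) by linarith
  qed
  have "((\<lambda>\<epsilon>. D \<epsilon> t1 u) \<longlongrightarrow> heat k t1 u powr (- p) - heat g (\<tau> - t1) u - 0 * barrier t1 u) (at_right 0)"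
    unfolding D_def by (intro tendsto_intros)
  then have "heat k t1 u powr (- p) - heat g (\<tau> - t1) u - 0 * barrier t1 u \<le> 0"
    by (rule tendsto_upperbound) (auto simp: eventually_at_right_less intro!: eventually_mono[OF eventually_at_right_less] neg)
  then show ?thesis by simp
qed

text \<open>The heat equation is available only at positive times, so the comparison starts at t1 >
  0 and t1 is sent to 0. The two sides call for different limit theorems, because only
  \<open>g\<close> has a growth bound.\<close>

lemma k_powr_minus_le_heat_g: "k u powr (- p) \<le> heat g \<tau> u"
proof -
  \<comment> \<open>The offset 2 keeps \<open>t n\<close> strictly below \<tau> already for n =
    0.\<close>
  define t where "t n = \<tau> / real (n + 2)" for n
  have t: "0 < t n" "t n < \<tau>" for n using \<tau>_pos by (auto simp: t_def divide_less_eq)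
  have lim: "t \<longlonglongrightarrow> 0" unfolding t_def by real_asymp
  obtain C where C: "\<And>x. g x \<le> C * exp ((norm x)\<^sup>2 / (32 * \<tau>))" using g_growth by blast
  have "(\<lambda>n. heat k (t n) u) \<longlonglongrightarrow> k u"
    using t k_pos lim \<tau>_pos by (intro heat_tendsto_at_start[of k \<tau>] k_cont k_int) (auto intro: less_imp_le)
  then have "(\<lambda>n. heat k (t n) u powr (- p)) \<longlonglongrightarrow> k u powr (- p)"
    using k_pos[of u] by (intro tendsto_powr) auto
  moreover have "(\<lambda>n. heat g (\<tau> - t n) u) \<longlonglongrightarrow> heat g \<tau> u"
  proof (rule heat_tendsto_at_end[OF g_cont less_imp_le[OF g_pos] \<tau>_pos C])
    show "(\<lambda>n. \<tau> - t n) \<longlonglongrightarrow> \<tau>" using tendsto_diff[OF tendsto_const[of \<tau>] lim] by simp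
  qed (use t in \<open>auto intro: less_imp_le\<close>)
  ultimately show ?thesis
    by (rule LIMSEQ_le) (use heat_k_powr_minus_le_heat_g t in blast)
qed

end

section \<open>Reduction of the risk\<close>

lemma beta_of_bounds:
  assumes "-1 < \<alpha>" "\<alpha> < 1"
  shows "0 < beta_of \<alpha>" "beta_of \<alpha> < 1"
  using assms by (auto simp: beta_of_def)

lemma f_alpha_ratio:
  assumes "-1 < \<alpha>" "\<alpha> < 1" "p \<ge> 0" "r > 0"
  shows "f_alpha \<alpha> (p / r) * r = 4 / (1 - \<alpha>\<^sup>2) * (r - p powr (1 - beta_of \<alpha>) * r powr beta_of \<alpha>)"
proof -
  have "(p / r) powr (1 - beta_of \<alpha>) * r = p powr (1 - beta_of \<alpha>) * r powr beta_of \<alpha>"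
    using assms by (simp add: powr_divide powr_diff)
  moreover have "(1 + \<alpha>) / 2 = 1 - beta_of \<alpha>" by (simp add: beta_of_def field_simps)
  ultimately show ?thesis
    unfolding f_alpha_def by (simp only: mult.assoc left_diff_distrib mult_1_left)
qed

text \<open>The part of the risk that depends on the predictive density, a Hellinger-type integral.
  Extended nonnegative values permit Tonelli's theorem before any integrability is known.\<close>

definition affinity :: "real \<Rightarrow> real \<Rightarrow> real \<Rightarrow> ('a::euclidean_space \<Rightarrow> 'a \<Rightarrow> real) \<Rightarrow> 'a \<Rightarrow> ennreal" where
  "affinity \<alpha> vx vy p \<mu> = (\<integral>\<^sup>+x. \<integral>\<^sup>+y.
     ennreal (p x y powr (1 - beta_of \<alpha>) * gauss (y - \<mu>) vy powr beta_of \<alpha> * gauss (x - \<mu>) vx) \<partial>lborel \<partial>lborel)"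

text \<open>Both Gaussian densities have mass 1, so the risk is a decreasing affine function of the
  affinity. The last hypothesis has two forms: on the Bayes side the risk integral is assumed to
  exist, while for the uniform predictor its existence is deduced from an explicitly computed finite
  affinity.\<close>

lemma risk_eq_affinity:
  fixes p :: "'a::euclidean_space \<Rightarrow> 'a \<Rightarrow> real"
  assumes \<alpha>: "-1 < \<alpha>" "\<alpha> < 1" and v: "vx > 0" "vy > 0" and p: "\<And>x y. p x y \<ge> 0"
    and loss: "\<And>x. integrable lborel (\<lambda>y. f_alpha \<alpha> (p x y / gauss (y - \<mu>) vy) * gauss (y - \<mu>) vy)"
    and risk: "integrable lborel (\<lambda>x. alpha_div \<alpha> vy p \<mu> x * gauss (x - \<mu>) vx)
      \<or> (\<lambda>x. \<integral>y. p x y powr (1 - beta_of \<alpha>) * gauss (y - \<mu>) vy powr beta_of \<alpha> \<partial>lborel) \<in> borel_measurable borel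
        \<and> affinity \<alpha> vx vy p \<mu> < \<infinity>"
  shows "affinity \<alpha> vx vy p \<mu> < \<infinity>"
    and "risk \<alpha> vx vy p \<mu> = 4 / (1 - \<alpha>\<^sup>2) * (1 - enn2real (affinity \<alpha> vx vy p \<mu>))"
proof -
  define \<beta> where "\<beta> = beta_of \<alpha>"
  define C where "C = 4 / (1 - \<alpha>\<^sup>2)"
  have C: "C > 0" using \<alpha> abs_square_less_1[of \<alpha>] by (simp add: C_def abs_less_iff)
  define h where "h x y = p x y powr (1 - \<beta>) * gauss (y - \<mu>) vy powr \<beta>" for x y
  define A where "A x = (\<integral>y. h x y \<partial>lborel)" for x
  have h0: "h x y \<ge> 0" for x y by (simp add: h_def)
  have A0: "A x \<ge> 0" for x unfolding A_def by (intro integral_nonneg_AE AE_I2 h0)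
  have f: "f_alpha \<alpha> (p x y / gauss (y - \<mu>) vy) * gauss (y - \<mu>) vy = C * (gauss (y - \<mu>) vy - h x y)" for x y
    using f_alpha_ratio[OF \<alpha> p gauss_pos[OF v(2)]] by (simp add: C_def h_def \<beta>_def)
  have hint: "integrable lborel (h x)" for x
  proof -
    have "integrable lborel (\<lambda>y. gauss (y - \<mu>) vy - inverse C * (C * (gauss (y - \<mu>) vy - h x y)))"
      by (rule Bochner_Integration.integrable_diff[OF integrable_gauss[OF v(2)] integrable_mult_right[OF loss[of x, unfolded f]]])
    moreover have "gauss (y - \<mu>) vy - inverse C * (C * (gauss (y - \<mu>) vy - h x y)) = h x y" for y
      using C by (simp flip: mult.assoc)
    ultimately show ?thesis by (simp only:)
  qed
  have div: "alpha_div \<alpha> vy p \<mu> x = C * (1 - A x)" for x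
    unfolding alpha_div_def f A_def using hint[of x] integrable_gauss[OF v(2), of \<mu>]
    by (simp add: integral_gauss[OF v(2)])
  have aff: "affinity \<alpha> vx vy p \<mu> = (\<integral>\<^sup>+x. ennreal (A x * gauss (x - \<mu>) vx) \<partial>lborel)"
    unfolding affinity_def
  proof (rule nn_integral_cong)
    fix x :: 'a
    have "(\<integral>\<^sup>+y. ennreal (h x y * gauss (x - \<mu>) vx) \<partial>lborel) = ennreal (\<integral>y. h x y * gauss (x - \<mu>) vx \<partial>lborel)"
      using hint[of x] h0 by (intro nn_integral_eq_integral integrable_mult_left AE_I2) auto
    also have "(\<integral>y. h x y * gauss (x - \<mu>) vx \<partial>lborel) = A x * gauss (x - \<mu>) vx"
      by (simp add: A_def)
    finally show "(\<integral>\<^sup>+y. ennreal (p x y powr (1 - beta_of \<alpha>) * gauss (y - \<mu>) vy powr beta_of \<alpha> * gauss (x - \<mu>) vx) \<partial>lborel)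
      = ennreal (A x * gauss (x - \<mu>) vx)"
      by (simp add: h_def \<beta>_def)
  qed
  have Aint: "integrable lborel (\<lambda>x. A x * gauss (x - \<mu>) vx)"
    using risk
  proof
    assume "integrable lborel (\<lambda>x. alpha_div \<alpha> vy p \<mu> x * gauss (x - \<mu>) vx)"
    then have "integrable lborel (\<lambda>x. gauss (x - \<mu>) vx - inverse C * (C * (1 - A x) * gauss (x - \<mu>) vx))"
      unfolding div by (intro Bochner_Integration.integrable_diff integrable_gauss v integrable_mult_right)
    moreover have "gauss (x - \<mu>) vx - inverse C * (C * (1 - A x) * gauss (x - \<mu>) vx) = A x * gauss (x - \<mu>) vx" for x
      using C by (simp add: field_simps)
    ultimately show ?thesis by (simp only:)
  next
    assume m: "(\<lambda>x. \<integral>y. p x y powr (1 - beta_of \<alpha>) * gauss (y - \<mu>) vy powr beta_of \<alpha> \<partial>lborel) \<in> borel_measurable borel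
        \<and> affinity \<alpha> vx vy p \<mu> < \<infinity>"
    then have [measurable]: "A \<in> borel_measurable borel"
      unfolding A_def h_def \<beta>_def by blast
    show ?thesis using m A0 by (intro integrableI_nonneg) (auto simp: aff)
  qed
  have eq: "affinity \<alpha> vx vy p \<mu> = ennreal (\<integral>x. A x * gauss (x - \<mu>) vx \<partial>lborel)"
    unfolding aff using A0 by (intro nn_integral_eq_integral Aint AE_I2) auto
  show "affinity \<alpha> vx vy p \<mu> < \<infinity>" by (simp add: eq)
  have "risk \<alpha> vx vy p \<mu> = (\<integral>x. C * (gauss (x - \<mu>) vx - A x * gauss (x - \<mu>) vx) \<partial>lborel)"
    unfolding risk_def div by (intro Bochner_Integration.integral_cong) (auto simp: algebra_simps)
  also have "\<dots> = C * (1 - (\<integral>x. A x * gauss (x - \<mu>) vx \<partial>lborel))"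
    using Aint integrable_gauss[OF v(1), of \<mu>] by (simp add: integral_gauss[OF v(1)])
  also have "(\<integral>x. A x * gauss (x - \<mu>) vx \<partial>lborel) = enn2real (affinity \<alpha> vx vy p \<mu>)"
    unfolding eq using A0 by (simp add: integral_nonneg_AE)
  finally show "risk \<alpha> vx vy p \<mu> = 4 / (1 - \<alpha>\<^sup>2) * (1 - enn2real (affinity \<alpha> vx vy p \<mu>))"
    by (simp add: C_def)
qed

lemma gamma_of_bounds:
  assumes "-1 < \<alpha>" "\<alpha> < 1" "vx > 0" "vy > 0"
  shows "0 < gamma_of \<alpha> vx vy" "gamma_of \<alpha> vx vy < 1"
proof -
  have "beta_of \<alpha> * vx / vy > 0" using beta_of_bounds[OF assms(1,2)] assms by simp
  then show "0 < gamma_of \<alpha> vx vy" "gamma_of \<alpha> vx vy < 1" by (auto simp: gamma_of_def)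
qed

text \<open>Completing the square: the precisions \<open>1 / vx\<close> and \<open>\<beta> / vy\<close> add up to \<open>1 / (vx * \<gamma>)\<close>,
  with weighted mean \<open>\<gamma> x + (1 - \<gamma>) y\<close>.\<close>

lemma gauss_complete_square:
  fixes x y \<mu> :: "'a::euclidean_space"
  assumes \<alpha>: "-1 < \<alpha>" "\<alpha> < 1" and v: "vx > 0" "vy > 0"
  defines "\<beta> \<equiv> beta_of \<alpha>" and "\<gamma> \<equiv> gamma_of \<alpha> vx vy"
  obtains c0 where "c0 > 0"
    "\<And>x y :: 'a. gauss (y - x) (vy / \<gamma>) powr (1 - \<beta>) * gauss (y - \<mu>) vy powr \<beta> * gauss (x - \<mu>) vx
      = c0 * gauss (\<gamma> *\<^sub>R x + (1 - \<gamma>) *\<^sub>R y - \<mu>) (vx * \<gamma>) * gauss (y - x) (vy / \<gamma>)"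
proof -
  have \<gamma>: "0 < \<gamma>" "\<gamma> < 1" using gamma_of_bounds[OF \<alpha> v] by (auto simp: \<gamma>_def)
  have \<beta>: "0 < \<beta>" "\<beta> < 1" using beta_of_bounds[OF \<alpha>] by (auto simp: \<beta>_def)
  have \<gamma>eq: "\<beta> * vx * \<gamma> = vy * (1 - \<gamma>)"
  proof -
    have "\<gamma> * (1 + \<beta> * vx / vy) = 1"
      using \<gamma> by (simp add: \<gamma>_def gamma_of_def \<beta>_def)
    then show ?thesis using v by (simp add: field_simps)
  qed
  define n where "n s = (2 * pi * s) powr (- real DIM('a) / 2)" for s
  have n: "n s > 0" if "s > 0" for s using that by (simp add: n_def)
  define c0 where "c0 = n (vy / \<gamma>) powr (1 - \<beta>) * n vy powr \<beta> * n vx / (n (vx * \<gamma>) * n (vy / \<gamma>))"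
  show ?thesis
  proof (rule that)
    show "c0 > 0" using n[of vx] n[of vy] n[of "vx * \<gamma>"] n[of "vy / \<gamma>"] v \<gamma> by (simp add: c0_def)
    fix x y :: 'a
    define X where "X = x - \<mu>"
    define Y where "Y = y - \<mu>"
    have w: "\<gamma> *\<^sub>R x + (1 - \<gamma>) *\<^sub>R y - \<mu> = \<gamma> *\<^sub>R X + (1 - \<gamma>) *\<^sub>R Y"
      by (simp add: X_def Y_def algebra_simps)
    have yx: "y - x = Y - X" by (simp add: X_def Y_def)
    have quad: "\<beta> * (norm Y)\<^sup>2 / vy + (norm X)\<^sup>2 / vx
      = (norm (\<gamma> *\<^sub>R X + (1 - \<gamma>) *\<^sub>R Y))\<^sup>2 / (vx * \<gamma>) + \<beta> * ((norm (Y - X))\<^sup>2 / (vy / \<gamma>))"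
    proof -
      define a b c where "a = X \<bullet> X" and "b = X \<bullet> Y" and "c = Y \<bullet> Y"
      \<comment> \<open>Eliminating \<beta> in favour of \<gamma> turns the claim into a rational
        identity in \<gamma> and the variances.\<close>
      have b1: "\<beta> = vy * (1 - \<gamma>) / (vx * \<gamma>)" using \<gamma>eq v \<gamma> by (simp add: field_simps)
      have n1: "(norm (\<gamma> *\<^sub>R X + (1 - \<gamma>) *\<^sub>R Y))\<^sup>2 = \<gamma>\<^sup>2 * a + 2 * \<gamma> * (1 - \<gamma>) * b + (1 - \<gamma>)\<^sup>2 * c"
        unfolding power2_norm_eq_inner a_def b_def c_def
        by (simp add: inner_add_left inner_add_right inner_commute[of Y X] algebra_simps power2_eq_square)
      have n2: "(norm (Y - X))\<^sup>2 = a - 2 * b + c"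
        unfolding power2_norm_eq_inner a_def b_def c_def
        by (simp add: inner_diff_left inner_diff_right inner_commute[of Y X])
      have n3: "(norm X)\<^sup>2 = a" "(norm Y)\<^sup>2 = c" by (auto simp: a_def c_def power2_norm_eq_inner)
      show ?thesis unfolding n1 n2 n3 b1 using v \<gamma>
        by (simp add: field_simps power2_eq_square)
    qed
    have e: "exp (- (norm (Y - X))\<^sup>2 / (2 * (vy / \<gamma>))) powr (1 - \<beta>) * exp (- (norm Y)\<^sup>2 / (2 * vy)) powr \<beta> * exp (- (norm X)\<^sup>2 / (2 * vx))
      = exp (- (norm (\<gamma> *\<^sub>R X + (1 - \<gamma>) *\<^sub>R Y))\<^sup>2 / (2 * (vx * \<gamma>))) * exp (- (norm (Y - X))\<^sup>2 / (2 * (vy / \<gamma>)))"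
    proof -
      define P where "P = (norm (Y - X))\<^sup>2 / (vy / \<gamma>)"
      define Q where "Q = (norm (\<gamma> *\<^sub>R X + (1 - \<gamma>) *\<^sub>R Y))\<^sup>2 / (vx * \<gamma>)"
      define y' where "y' = (norm Y)\<^sup>2 / vy"
      define x' where "x' = (norm X)\<^sup>2 / vx"
      have half: "- (norm (Y - X))\<^sup>2 / (2 * (vy / \<gamma>)) = - P / 2"
        "- (norm (\<gamma> *\<^sub>R X + (1 - \<gamma>) *\<^sub>R Y))\<^sup>2 / (2 * (vx * \<gamma>)) = - Q / 2"
        "- (norm Y)\<^sup>2 / (2 * vy) = - y' / 2" "- (norm X)\<^sup>2 / (2 * vx) = - x' / 2"
        by (auto simp: P_def Q_def y'_def x'_def)
      have q: "\<beta> * y' + x' = Q + \<beta> * P" using quad by (simp add: P_def Q_def y'_def x'_def)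
      have "- P / 2 * (1 - \<beta>) + - y' / 2 * \<beta> + - x' / 2 = - (\<beta> * y' + x') / 2 + \<beta> * P / 2 - P / 2"
        by (simp add: field_simps)
      also have "\<dots> = - Q / 2 + - P / 2" unfolding q by (simp add: field_simps)
      finally show ?thesis unfolding half exp_powr_real exp_add[symmetric] by simp
    qed
    have "gauss (Y - X) (vy / \<gamma>) powr (1 - \<beta>) * gauss Y vy powr \<beta> * gauss X vx
       = n (vy / \<gamma>) powr (1 - \<beta>) * n vy powr \<beta> * n vx *
         (exp (- (norm (Y - X))\<^sup>2 / (2 * (vy / \<gamma>))) powr (1 - \<beta>) * exp (- (norm Y)\<^sup>2 / (2 * vy)) powr \<beta> * exp (- (norm X)\<^sup>2 / (2 * vx)))"
      unfolding gauss_def n_def[symmetric] using n v \<gamma> by (simp add: powr_mult less_imp_le)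
    also have "\<dots> = c0 * gauss (\<gamma> *\<^sub>R X + (1 - \<gamma>) *\<^sub>R Y) (vx * \<gamma>) * gauss (Y - X) (vy / \<gamma>)"
      unfolding e unfolding gauss_def n_def[symmetric] c0_def
      using n[of "vx * \<gamma>"] n[of "vy / \<gamma>"] v \<gamma> by simp
    finally show "gauss (y - x) (vy / \<gamma>) powr (1 - \<beta>) * gauss (y - \<mu>) vy powr \<beta> * gauss (x - \<mu>) vx
      = c0 * gauss (\<gamma> *\<^sub>R x + (1 - \<gamma>) *\<^sub>R y - \<mu>) (vx * \<gamma>) * gauss (y - x) (vy / \<gamma>)"
      unfolding w yx by (simp add: X_def Y_def)
  qed
qed


text \<open>Writing y as x plus a scaled standard normal z turns \<gamma> x + (1 - \<gamma>) y into
  x + \<xi> z, which is where \<xi> comes from. With this point u as the outer variable, the power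
  of \<open>m\<close> leaves the inner integral. The constant \<open>c0\<close> is fixed before
  \<open>m\<close> and \<open>M\<close>, so both predictors share it.\<close>

lemma affinity_eq:
  fixes \<mu> :: "'a::euclidean_space"
  assumes \<alpha>: "-1 < \<alpha>" "\<alpha> < 1" and v: "vx > 0" "vy > 0"
  defines "\<beta> \<equiv> beta_of \<alpha>" and "\<gamma> \<equiv> gamma_of \<alpha> vx vy" and "\<xi> \<equiv> xi_of \<alpha> vx vy"
  obtains c0 where "c0 > 0"
    "\<And>m M :: 'a \<Rightarrow> real. \<lbrakk>m \<in> borel_measurable borel; M \<in> borel_measurable borel; \<And>x. m x > 0; \<And>x. M x > 0\<rbrakk> \<Longrightarrow>
      affinity \<alpha> vx vy (\<lambda>x y. m (\<gamma> *\<^sub>R x + (1 - \<gamma>) *\<^sub>R y) powr (1 / \<beta>) / M x * gauss (y - x) (vy / \<gamma>)) \<mu>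
      = ennreal c0 * (\<integral>\<^sup>+u. ennreal (m u powr (1 / \<beta> - 1) * gauss (u - \<mu>) (vx * \<gamma>)) *
          (\<integral>\<^sup>+z. ennreal (M (u + \<xi> *\<^sub>R z) powr (- (1 - \<beta>)) * gauss z 1) \<partial>lborel) \<partial>lborel)"
proof -
  have \<gamma>: "0 < \<gamma>" "\<gamma> < 1" using gamma_of_bounds[OF \<alpha> v] by (auto simp: \<gamma>_def)
  have \<beta>: "0 < \<beta>" "\<beta> < 1" using beta_of_bounds[OF \<alpha>] by (auto simp: \<beta>_def)
  obtain c0 where c0: "c0 > 0"
    "\<And>x y :: 'a. gauss (y - x) (vy / \<gamma>) powr (1 - \<beta>) * gauss (y - \<mu>) vy powr \<beta> * gauss (x - \<mu>) vx
      = c0 * gauss (\<gamma> *\<^sub>R x + (1 - \<gamma>) *\<^sub>R y - \<mu>) (vx * \<gamma>) * gauss (y - x) (vy / \<gamma>)"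
    unfolding \<beta>_def \<gamma>_def using gauss_complete_square[OF \<alpha> v] by blast
  show ?thesis
  proof (rule that[OF c0(1)])
    fix m M :: "'a \<Rightarrow> real"
    assume [measurable]: "m \<in> borel_measurable borel" "M \<in> borel_measurable borel"
      and m: "\<And>x. m x > 0" and M: "\<And>x. M x > 0"
    define F where "F x w = m w powr (1 / \<beta> - 1) * gauss (w - \<mu>) (vx * \<gamma>) * M x powr (- (1 - \<beta>))" for x w
    have F0: "F x w \<ge> 0" for x w by (simp add: F_def)
    have F_meas [measurable]: "(\<lambda>v. F (f v) (h v)) \<in> borel_measurable N"
      if [measurable]: "f \<in> borel_measurable N" "h \<in> borel_measurable N" for f h and N :: "'b measure"
      unfolding F_def by measurable
    let ?p = "\<lambda>x y. m (\<gamma> *\<^sub>R x + (1 - \<gamma>) *\<^sub>R y) powr (1 / \<beta>) / M x * gauss (y - x) (vy / \<gamma>)"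
    have "affinity \<alpha> vx vy ?p \<mu> = (\<integral>\<^sup>+x. \<integral>\<^sup>+y. ennreal c0 *
        (ennreal (F x (\<gamma> *\<^sub>R x + (1 - \<gamma>) *\<^sub>R y)) * ennreal (gauss (y - x) (vy / \<gamma>))) \<partial>lborel \<partial>lborel)"
      unfolding affinity_def \<beta>_def[symmetric]
    proof (intro nn_integral_cong)
      fix x y :: 'a
      define w where "w = \<gamma> *\<^sub>R x + (1 - \<gamma>) *\<^sub>R y"
      have "(m w powr (1 / \<beta>) / M x) powr (1 - \<beta>) = m w powr (1 / \<beta> - 1) * M x powr (- (1 - \<beta>))"
      proof -
        have "1 / \<beta> * (1 - \<beta>) = 1 / \<beta> - 1" using \<beta> by (simp add: field_simps)
        then show ?thesis using m[of w] M[of x] by (simp add: powr_divide powr_powr powr_minus_divide[of "M x" "1 - \<beta>", simplified])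
      qed
      moreover have "?p x y powr (1 - \<beta>) = (m w powr (1 / \<beta>) / M x) powr (1 - \<beta>) * gauss (y - x) (vy / \<gamma>) powr (1 - \<beta>)"
        unfolding w_def[symmetric] by (rule powr_mult)
      ultimately have "?p x y powr (1 - \<beta>) * gauss (y - \<mu>) vy powr \<beta> * gauss (x - \<mu>) vx
          = (m w powr (1 / \<beta> - 1) * M x powr (- (1 - \<beta>))) *
            (gauss (y - x) (vy / \<gamma>) powr (1 - \<beta>) * gauss (y - \<mu>) vy powr \<beta> * gauss (x - \<mu>) vx)"
        by (simp only: mult.assoc)
      also have "\<dots> = c0 * (F x w * gauss (y - x) (vy / \<gamma>))"
        unfolding c0(2) by (simp add: F_def w_def)
      finally show "ennreal (?p x y powr (1 - \<beta>) * gauss (y - \<mu>) vy powr \<beta> * gauss (x - \<mu>) vx)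
        = ennreal c0 * (ennreal (F x (\<gamma> *\<^sub>R x + (1 - \<gamma>) *\<^sub>R y)) * ennreal (gauss (y - x) (vy / \<gamma>)))"
        using c0(1) F0 by (simp add: ennreal_mult w_def)
    qed
    also have "\<dots> = ennreal c0 * (\<integral>\<^sup>+x. \<integral>\<^sup>+y. ennreal (F x (\<gamma> *\<^sub>R x + (1 - \<gamma>) *\<^sub>R y)) *
        ennreal (gauss (y - x) (vy / \<gamma>)) \<partial>lborel \<partial>lborel)"
      by (simp add: nn_integral_cmult)
    also have "(\<integral>\<^sup>+x. \<integral>\<^sup>+y. ennreal (F x (\<gamma> *\<^sub>R x + (1 - \<gamma>) *\<^sub>R y)) * ennreal (gauss (y - x) (vy / \<gamma>)) \<partial>lborel \<partial>lborel)
        = (\<integral>\<^sup>+x. \<integral>\<^sup>+z. ennreal (F x (x + \<xi> *\<^sub>R z)) * ennreal (gauss z 1) \<partial>lborel \<partial>lborel)"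
    proof (rule nn_integral_cong)
      fix x :: 'a
      have "\<gamma> *\<^sub>R x + (1 - \<gamma>) *\<^sub>R (x + sqrt (vy / \<gamma>) *\<^sub>R z) = x + \<xi> *\<^sub>R z" for z :: 'a
        by (simp add: \<xi>_def xi_of_def \<gamma>_def algebra_simps)
      then show "(\<integral>\<^sup>+y. ennreal (F x (\<gamma> *\<^sub>R x + (1 - \<gamma>) *\<^sub>R y)) * ennreal (gauss (y - x) (vy / \<gamma>)) \<partial>lborel)
        = (\<integral>\<^sup>+z. ennreal (F x (x + \<xi> *\<^sub>R z)) * ennreal (gauss z 1) \<partial>lborel)"
        using nn_integral_gauss_affine[of "\<lambda>y. ennreal (F x (\<gamma> *\<^sub>R x + (1 - \<gamma>) *\<^sub>R y))" "vy / \<gamma>" x] v \<gamma> by simp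
    qed
    also have "\<dots> = (\<integral>\<^sup>+z. \<integral>\<^sup>+x. ennreal (F x (x + \<xi> *\<^sub>R z)) * ennreal (gauss z 1) \<partial>lborel \<partial>lborel)"
      by (rule lborel_pair.Fubini'[symmetric]) simp
    also have "\<dots> = (\<integral>\<^sup>+z. \<integral>\<^sup>+u. ennreal (F (u - \<xi> *\<^sub>R z) u) * ennreal (gauss z 1) \<partial>lborel \<partial>lborel)"
    proof (rule nn_integral_cong)
      fix z :: 'a
      show "(\<integral>\<^sup>+x. ennreal (F x (x + \<xi> *\<^sub>R z)) * ennreal (gauss z 1) \<partial>lborel)
        = (\<integral>\<^sup>+u. ennreal (F (u - \<xi> *\<^sub>R z) u) * ennreal (gauss z 1) \<partial>lborel)"
        by (subst nn_integral_lborel_affine[where c=1 and t="- \<xi> *\<^sub>R z"]) (auto simp: algebra_simps)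
    qed
    also have "\<dots> = (\<integral>\<^sup>+u. \<integral>\<^sup>+z. ennreal (F (u - \<xi> *\<^sub>R z) u) * ennreal (gauss z 1) \<partial>lborel \<partial>lborel)"
      by (rule lborel_pair.Fubini') simp
    also have "\<dots> = (\<integral>\<^sup>+u. ennreal (m u powr (1 / \<beta> - 1) * gauss (u - \<mu>) (vx * \<gamma>)) *
          (\<integral>\<^sup>+z. ennreal (M (u + \<xi> *\<^sub>R z) powr (- (1 - \<beta>)) * gauss z 1) \<partial>lborel) \<partial>lborel)"
    proof (rule nn_integral_cong)
      fix u :: 'a
      \<comment> \<open>The reflection of z preserves the Gaussian and turns u - \<xi> z into u +
        \<xi> z.\<close>
      have "(\<integral>\<^sup>+z. ennreal (F (u - \<xi> *\<^sub>R z) u) * ennreal (gauss z 1) \<partial>lborel)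
        = (\<integral>\<^sup>+z. ennreal (F (u + \<xi> *\<^sub>R z) u) * ennreal (gauss z 1) \<partial>lborel)"
        by (subst nn_integral_lborel_affine[where c="-1" and t=0]) (auto simp: gauss_def)
      also have "\<dots> = (\<integral>\<^sup>+z. ennreal (m u powr (1 / \<beta> - 1) * gauss (u - \<mu>) (vx * \<gamma>)) *
          ennreal (M (u + \<xi> *\<^sub>R z) powr (- (1 - \<beta>)) * gauss z 1) \<partial>lborel)"
        by (intro nn_integral_cong) (simp add: F_def mult_ac flip: ennreal_mult)
      also have "\<dots> = ennreal (m u powr (1 / \<beta> - 1) * gauss (u - \<mu>) (vx * \<gamma>)) *
          (\<integral>\<^sup>+z. ennreal (M (u + \<xi> *\<^sub>R z) powr (- (1 - \<beta>)) * gauss z 1) \<partial>lborel)"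
        by (rule nn_integral_cmult) simp
      finally show "(\<integral>\<^sup>+z. ennreal (F (u - \<xi> *\<^sub>R z) u) * ennreal (gauss z 1) \<partial>lborel)
        = ennreal (m u powr (1 / \<beta> - 1) * gauss (u - \<mu>) (vx * \<gamma>)) *
          (\<integral>\<^sup>+z. ennreal (M (u + \<xi> *\<^sub>R z) powr (- (1 - \<beta>)) * gauss z 1) \<partial>lborel)" .
    qed
    finally show "affinity \<alpha> vx vy ?p \<mu>
      = ennreal c0 * (\<integral>\<^sup>+u. ennreal (m u powr (1 / \<beta> - 1) * gauss (u - \<mu>) (vx * \<gamma>)) *
          (\<integral>\<^sup>+z. ennreal (M (u + \<xi> *\<^sub>R z) powr (- (1 - \<beta>)) * gauss z 1) \<partial>lborel) \<partial>lborel)" .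
  qed
qed

section \<open>Jensen's inequality and the final assembly\<close>

lemma kappa_of_gt:
  assumes "-1 < \<alpha>" "\<alpha> < 1"
  shows "1 / beta_of \<alpha> < real_of_int (kappa_of \<alpha>)"
proof -
  have "1 / beta_of \<alpha> > 0" using beta_of_bounds[OF assms] by simp
  then have "kappa_of \<alpha> = \<lfloor>1 / beta_of \<alpha>\<rfloor> + 1"
    unfolding kappa_of_def by (intro Least_equality) (auto simp: floor_less_iff, linarith+)
  then show ?thesis by linarith
qed

text \<open>Jensen's inequality for the concave power q / n, obtained from its tangent: Young's
  inequality is applied to \<open>f z ^ n\<close> divided by its mean \<open>K\<close>, and
  integration then makes the right-hand side exactly \<open>K\<close> to the power q / n.\<close>

lemma EZ_powr_le:
  fixes f :: "'a::euclidean_space \<Rightarrow> real"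
  assumes pos: "\<And>z. f z > 0" and q: "0 \<le> q" "q \<le> real n" "n > 0"
    and intq: "integrable lborel (\<lambda>z. f z powr q * gauss z 1)"
    and intn: "integrable lborel (\<lambda>z. f z ^ n * gauss z 1)" and E: "EZ (\<lambda>z. f z ^ n) > 0"
  shows "EZ (\<lambda>z. f z powr q) \<le> EZ (\<lambda>z. f z ^ n) powr (q / real n)"
proof -
  define K where "K = EZ (\<lambda>z. f z ^ n)"
  define \<theta> where "\<theta> = q / real n"
  have \<theta>: "0 \<le> \<theta>" "\<theta> \<le> 1" using q by (auto simp: \<theta>_def)
  have K: "K > 0" using E by (simp add: K_def)
  have "f z powr q * gauss z 1 \<le> K powr \<theta> * (\<theta> / K * (f z ^ n * gauss z 1) + (1 - \<theta>) * gauss z 1)" for z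
  proof -
    have "(f z ^ n / K) powr \<theta> * 1 powr (1 - \<theta>) \<le> \<theta> * (f z ^ n / K) + (1 - \<theta>) * 1"
      using pos[of z] K \<theta> by (intro Youngs_inequality_0) auto
    moreover have "(f z ^ n / K) powr \<theta> = f z powr q / K powr \<theta>"
      using pos[of z] K q by (simp add: powr_divide powr_powr \<theta>_def flip: powr_realpow)
    ultimately have "f z powr q \<le> K powr \<theta> * (\<theta> / K * f z ^ n + (1 - \<theta>))"
      using K by (simp add: field_simps)
    from mult_right_mono[OF this gauss_nonneg[of z 1]] show ?thesis by (simp add: algebra_simps)
  qed
  then have "EZ (\<lambda>z. f z powr q) \<le> (\<integral>z. K powr \<theta> * (\<theta> / K * (f z ^ n * gauss z 1) + (1 - \<theta>) * gauss z 1) \<partial>lborel)"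
    unfolding EZ_def using intq intn integrable_gauss[of 1 "0::'a"] by (intro integral_mono) auto
  also have "\<dots> = K powr \<theta> * (\<theta> / K * K + (1 - \<theta>))"
    using intn integrable_gauss[of 1 "0::'a"] integral_gauss[of 1 "0::'a"] by (simp add: K_def EZ_def)
  also have "\<dots> = K powr \<theta>" using K by simp
  finally show ?thesis by (simp add: K_def \<theta>_def)
qed

theorem theorem3:
  fixes prior :: "'a::euclidean_space \<Rightarrow> real"
    and \<alpha> vx vy :: real and \<mu> :: 'a
  assumes dim: "DIM('a) \<ge> 3"
    and alpha: "-1 < \<alpha>" "\<alpha> < 1"
    and vpos: "vx > 0" "vy > 0"
    and nonint: "1 / beta_of \<alpha> \<notin> \<int>"
    \<comment> \<open>prior: nonnegative measurable (possibly improper) with finite, positive, C^2 marginals\<close>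
    and prior_meas: "prior \<in> borel_measurable lborel"
    and prior_nonneg: "\<And>m. prior m \<ge> 0"
    and marg_int: "\<And>x v. v > 0 \<Longrightarrow> integrable lborel (\<lambda>m. gauss (x - m) v * prior m)"
    and marg_pos: "\<And>x v. v > 0 \<Longrightarrow> marg prior x v > 0"
    and marg_C2: "\<And>v. v > 0 \<Longrightarrow> C2 (\<lambda>x. marg prior x v)"
    \<comment> \<open>finiteness of the expectations involved\<close>
    and int_norm: "\<And>x. integrable lborel
        (\<lambda>z. marg prior (x + xi_of \<alpha> vx vy *\<^sub>R z) (vx * gamma_of \<alpha> vx vy) powr (1 / beta_of \<alpha>) * gauss z 1)"
    and int_kappa: "\<And>u t. 0 \<le> t \<Longrightarrow> t \<le> xi_of \<alpha> vx vy \<Longrightarrow> integrable lborel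
        (\<lambda>z. marg prior (t *\<^sub>R z + u) (vx * gamma_of \<alpha> vx vy) ^ nat (kappa_of \<alpha>) * gauss z 1)"
    and G_C2: "\<And>t. 0 \<le> t \<Longrightarrow> t \<le> xi_of \<alpha> vx vy \<Longrightarrow>
        C2 (\<lambda>u. EZ (\<lambda>z. marg prior (t *\<^sub>R z + u) (vx * gamma_of \<alpha> vx vy) ^ nat (kappa_of \<alpha>))
                 powr (c_of \<alpha> / real_of_int (kappa_of \<alpha>)))"
    and loss_int: "\<And>x. integrable lborel (\<lambda>y. f_alpha \<alpha> (bayes_pred prior vx vy \<alpha> x y / gauss (y - \<mu>) vy)
                                             * gauss (y - \<mu>) vy)"
    and risk_int: "integrable lborel (\<lambda>x. alpha_div \<alpha> vy (bayes_pred prior vx vy \<alpha>) \<mu> x * gauss (x - \<mu>) vx)"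
    \<comment> \<open>the superharmonicity-type condition\<close>
    and super: "\<And>u t. 0 \<le> t \<Longrightarrow> t \<le> xi_of \<alpha> vx vy \<Longrightarrow>
        laplacian (\<lambda>w. EZ (\<lambda>z. marg prior (t *\<^sub>R z + w) (vx * gamma_of \<alpha> vx vy) ^ nat (kappa_of \<alpha>))
                         powr (c_of \<alpha> / real_of_int (kappa_of \<alpha>))) u \<le> 0"
  shows "risk \<alpha> vx vy (bayes_pred prior vx vy \<alpha>) \<mu> \<le> risk \<alpha> vx vy (unif_pred vx vy \<alpha>) \<mu>"
proof -
  define \<beta> where "\<beta> = beta_of \<alpha>"
  define \<gamma> where "\<gamma> = gamma_of \<alpha> vx vy"
  define \<xi> where "\<xi> = xi_of \<alpha> vx vy"
  define \<kappa> where "\<kappa> = nat (kappa_of \<alpha>)"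
  define q where "q = 1 / \<beta>"
  \<comment> \<open>Chosen so that \<open>k\<close> to the power -p is \<open>m\<close> to the power
    -(q - 1).\<close>
  define p where "p = (q - 1) / real \<kappa>"
  define m where "m x = marg prior x (vx * \<gamma>)" for x
  define M where "M x = EZ (\<lambda>z. m (x + \<xi> *\<^sub>R z) powr q)" for x
  define k where "k x = m x ^ \<kappa>" for x
  note folds = \<beta>_def[symmetric] \<gamma>_def[symmetric] \<xi>_def[symmetric] \<kappa>_def[symmetric]
  have \<beta>: "0 < \<beta>" "\<beta> < 1" using beta_of_bounds[OF alpha] by (auto simp: \<beta>_def)
  have \<gamma>: "0 < \<gamma>" "\<gamma> < 1" using gamma_of_bounds[OF alpha vpos] by (auto simp: \<gamma>_def)
  have \<xi>: "\<xi> > 0" using \<gamma> vpos by (simp add: \<xi>_def xi_of_def \<gamma>_def)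
  have q: "q > 1" using \<beta> by (simp add: q_def)
  have kap: "kappa_of \<alpha> > 0" and q\<kappa>: "q < real \<kappa>"
    using kappa_of_gt[OF alpha] q by (auto simp: \<kappa>_def q_def \<beta>_def)
  have real_kap: "real_of_int (kappa_of \<alpha>) = real \<kappa>" using kap by (simp add: \<kappa>_def)
  have p: "0 < p" "p < 1" using q q\<kappa> by (auto simp: p_def field_simps)
  have c_eq: "c_of \<alpha> / real_of_int (kappa_of \<alpha>) = (1 - p) / 2"
    using q q\<kappa> unfolding c_of_def real_kap by (simp add: p_def q_def \<beta>_def field_simps)
  have m_pos: "m x > 0" for x unfolding m_def using marg_pos vpos \<gamma> by simp
  have m_cont: "continuous_on UNIV m"
    unfolding m_def using marg_C2[of "vx * \<gamma>"] vpos \<gamma> by (intro C2_imp_continuous) simp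
  then have [measurable]: "m \<in> borel_measurable borel" by (rule borel_measurable_continuous_onI)
  have heat_k: "heat k s x = EZ (\<lambda>z. m (sqrt s *\<^sub>R z + x) ^ \<kappa>)" for s x
    by (simp add: heat_def k_def add.commute)
  have sqrt_le: "sqrt s \<le> \<xi>" if "s \<le> \<xi>\<^sup>2" for s
    using \<xi> real_sqrt_le_mono[OF that] by simp
  interpret superharmonic_heat k "\<xi>\<^sup>2" p
  proof
    show "continuous_on UNIV k" unfolding k_def by (intro continuous_intros m_cont)
    show "k x > 0" for x using m_pos[of x] by (simp add: k_def)
    show "\<xi>\<^sup>2 > 0" using \<xi> by simp
    show "integrable lborel (\<lambda>z. k (x + sqrt s *\<^sub>R z) * gauss z 1)" if "0 \<le> s" "s \<le> \<xi>\<^sup>2" for s x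
      using int_kappa[of "sqrt s" x] that sqrt_le[of s] unfolding folds m_def[symmetric] by (simp add: k_def add.commute)
    show "C2 (\<lambda>x. heat k s x powr ((1 - p) / 2))" if "0 < s" "s \<le> \<xi>\<^sup>2" for s
      using G_C2[of "sqrt s"] that sqrt_le[of s] unfolding folds m_def[symmetric] c_eq heat_k by simp
    show "laplacian (\<lambda>x. heat k s x powr ((1 - p) / 2)) x \<le> 0" if "0 < s" "s \<le> \<xi>\<^sup>2" for s x
      using super[of "sqrt s"] that sqrt_le[of s] unfolding folds m_def[symmetric] c_eq heat_k by simp
  qed (use p in auto)
  have M_meas [measurable]: "M \<in> borel_measurable borel"
    unfolding M_def EZ_def by measurable
  have normM: "integrable lborel (\<lambda>z. m (x + \<xi> *\<^sub>R z) powr q * gauss z 1)" for x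
    using int_norm[of x] by (simp add: folds m_def q_def)
  have M_pos: "M x > 0" for x
    using heat_pos[of "\<lambda>x. m x powr q" x "\<xi>\<^sup>2"] normM[of x] m_pos \<xi>
    by (simp add: M_def heat_def less_imp_neq[symmetric])
  have M_le: "M x \<le> heat k (\<xi>\<^sup>2) x powr (q / real \<kappa>)" for x
    using EZ_powr_le[of "\<lambda>z. m (x + \<xi> *\<^sub>R z)" q \<kappa>] normM[of x] k_int[of "\<xi>\<^sup>2" x] heat_k_pos[of "\<xi>\<^sup>2" x]
      m_pos q q\<kappa> \<xi> by (simp add: M_def heat_def k_def)
  have key: "ennreal (m u powr (- (q - 1))) \<le> (\<integral>\<^sup>+z. ennreal (M (u + \<xi> *\<^sub>R z) powr (- (1 - \<beta>)) * gauss z 1) \<partial>lborel)" for u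
  proof -
    have "m u powr (- (q - 1)) = k u powr (- p)"
      using m_pos[of u] q q\<kappa> by (simp add: k_def p_def powr_powr flip: powr_realpow)
    also have "\<dots> \<le> heat g (\<xi>\<^sup>2) u" by (rule k_powr_minus_le_heat_g)
    finally have "ennreal (m u powr (- (q - 1))) \<le> ennreal (heat g (\<xi>\<^sup>2) u)" by (rule ennreal_leI)
    also have "\<dots> = (\<integral>\<^sup>+z. ennreal (g (u + \<xi> *\<^sub>R z) * gauss z 1) \<partial>lborel)"
      using g_int[of "\<xi>\<^sup>2" u] g_pos \<xi> unfolding heat_def EZ_def
      by (subst nn_integral_eq_integral) (auto intro!: AE_I2 mult_nonneg_nonneg intro: less_imp_le)
    also have "\<dots> \<le> (\<integral>\<^sup>+z. ennreal (M (u + \<xi> *\<^sub>R z) powr (- (1 - \<beta>)) * gauss z 1) \<partial>lborel)"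
    proof (intro nn_integral_mono ennreal_leI mult_right_mono gauss_nonneg)
      fix z
      let ?x = "u + \<xi> *\<^sub>R z"
      have "(heat k (\<xi>\<^sup>2) ?x powr (q / real \<kappa>)) powr (- (1 - \<beta>)) \<le> M ?x powr (- (1 - \<beta>))"
        using M_pos M_le \<beta> by (intro powr_mono2') auto
      \<comment> \<open>Since q \<beta> = 1, the product q (1 - \<beta>) is exactly q - 1.\<close>
      moreover have "q / real \<kappa> * (- (1 - \<beta>)) = - p"
        using \<beta> q\<kappa> q by (simp add: p_def q_def divide_simps)
      ultimately show "g ?x \<le> M ?x powr (- (1 - \<beta>))" by (simp only: g_def powr_powr)
    qed
    finally show ?thesis .
  qed
  obtain c0 where c0: "c0 > 0" and aff:
    "\<And>m M :: 'a \<Rightarrow> real. \<lbrakk>m \<in> borel_measurable borel; M \<in> borel_measurable borel; \<And>x. m x > 0; \<And>x. M x > 0\<rbrakk> \<Longrightarrow>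
      affinity \<alpha> vx vy (\<lambda>x y. m (\<gamma> *\<^sub>R x + (1 - \<gamma>) *\<^sub>R y) powr (1 / \<beta>) / M x * gauss (y - x) (vy / \<gamma>)) \<mu>
      = ennreal c0 * (\<integral>\<^sup>+u. ennreal (m u powr (1 / \<beta> - 1) * gauss (u - \<mu>) (vx * \<gamma>)) *
          (\<integral>\<^sup>+z. ennreal (M (u + \<xi> *\<^sub>R z) powr (- (1 - \<beta>)) * gauss z 1) \<partial>lborel) \<partial>lborel)"
    unfolding \<beta>_def \<gamma>_def \<xi>_def using affinity_eq[OF alpha vpos, of \<mu>] by blast
  have bayes: "bayes_pred prior vx vy \<alpha> = (\<lambda>x y. m (\<gamma> *\<^sub>R x + (1 - \<gamma>) *\<^sub>R y) powr (1 / \<beta>) / M x * gauss (y - x) (vy / \<gamma>))"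
    by (simp add: fun_eq_iff bayes_pred_def Let_def folds m_def M_def q_def)
  have v_eq: "vy / \<gamma> = vy + \<beta> * vx"
    using vpos by (simp add: \<gamma>_def gamma_of_def \<beta>_def field_simps)
  \<comment> \<open>The uniform predictor is the instance m = M = 1 of the same formula, so its
    affinity evaluates to \<open>c0\<close> exactly.\<close>
  have unif: "unif_pred vx vy \<alpha> = (\<lambda>x y :: 'a. 1 powr (1 / \<beta>) / 1 * gauss (y - x) (vy / \<gamma>))"
    by (simp add: fun_eq_iff unif_pred_def v_eq \<beta>_def)
  have v\<gamma>: "vx * \<gamma> > 0" "vy / \<gamma> > 0" using vpos \<gamma> by auto
  have aff_unif: "affinity \<alpha> vx vy (unif_pred vx vy \<alpha>) \<mu> = ennreal c0"
    unfolding unif using aff[of "\<lambda>_. 1" "\<lambda>_. 1"]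
    by (simp add: nn_integral_gauss_1 nn_integral_gauss[OF v\<gamma>(1)])
  have aff_bayes: "ennreal c0 \<le> affinity \<alpha> vx vy (bayes_pred prior vx vy \<alpha>) \<mu>"
  proof -
    have "ennreal c0 = ennreal c0 * (\<integral>\<^sup>+u. ennreal (gauss (u - \<mu>) (vx * \<gamma>)) \<partial>lborel)"
      by (simp add: nn_integral_gauss[OF v\<gamma>(1)])
    also have "\<dots> \<le> ennreal c0 * (\<integral>\<^sup>+u. ennreal (m u powr (1 / \<beta> - 1) * gauss (u - \<mu>) (vx * \<gamma>)) *
          (\<integral>\<^sup>+z. ennreal (M (u + \<xi> *\<^sub>R z) powr (- (1 - \<beta>)) * gauss z 1) \<partial>lborel) \<partial>lborel)"
    proof (intro mult_left_mono nn_integral_mono)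
      fix u :: 'a
      have "gauss (u - \<mu>) (vx * \<gamma>) = (m u powr (1 / \<beta> - 1) * gauss (u - \<mu>) (vx * \<gamma>)) * m u powr (- (q - 1))"
        using m_pos[of u] by (simp add: q_def mult_ac flip: powr_add)
      then have "ennreal (gauss (u - \<mu>) (vx * \<gamma>))
          = ennreal (m u powr (1 / \<beta> - 1) * gauss (u - \<mu>) (vx * \<gamma>)) * ennreal (m u powr (- (q - 1)))"
        by (simp flip: ennreal_mult)
      also have "\<dots> \<le> ennreal (m u powr (1 / \<beta> - 1) * gauss (u - \<mu>) (vx * \<gamma>)) *
          (\<integral>\<^sup>+z. ennreal (M (u + \<xi> *\<^sub>R z) powr (- (1 - \<beta>)) * gauss z 1) \<partial>lborel)"
        by (intro mult_left_mono key) auto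
      finally show "ennreal (gauss (u - \<mu>) (vx * \<gamma>)) \<le> \<dots>" .
    qed auto
    finally show ?thesis unfolding bayes using aff[of m M] m_pos M_pos by simp
  qed
  have bayes_nonneg: "bayes_pred prior vx vy \<alpha> x y \<ge> 0" for x y
    unfolding bayes using M_pos[of x] by simp
  note risk_bayes = risk_eq_affinity[OF alpha vpos bayes_nonneg loss_int disjI1[OF risk_int]]
  have unif_nonneg: "unif_pred vx vy \<alpha> x y \<ge> 0" for x y :: 'a by (simp add: unif_pred_def)
  \<comment> \<open>A weighted geometric mean of two densities lies below their weighted arithmetic
    mean. This proves for the uniform predictor what is assumed for the Bayes one.\<close>
  have unif_int: "integrable lborel (\<lambda>y. unif_pred vx vy \<alpha> x y powr (1 - \<beta>) * gauss (y - \<mu>) vy powr \<beta>)" for x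
  proof (rule Bochner_Integration.integrable_bound)
    show "integrable lborel (\<lambda>y. (1 - \<beta>) * gauss (y - x) (vy / \<gamma>) + \<beta> * gauss (y - \<mu>) vy)"
      using integrable_gauss[OF v\<gamma>(2), of x] integrable_gauss[OF vpos(2), of \<mu>] by simp
    show "AE y in lborel. norm (unif_pred vx vy \<alpha> x y powr (1 - \<beta>) * gauss (y - \<mu>) vy powr \<beta>)
        \<le> norm ((1 - \<beta>) * gauss (y - x) (vy / \<gamma>) + \<beta> * gauss (y - \<mu>) vy)"
    proof (rule AE_I2)
      fix y
      have "gauss (y - x) (vy / \<gamma>) powr (1 - \<beta>) * gauss (y - \<mu>) vy powr \<beta>
          \<le> (1 - \<beta>) * gauss (y - x) (vy / \<gamma>) + \<beta> * gauss (y - \<mu>) vy"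
        using \<beta> by (intro Youngs_inequality_0 gauss_pos v\<gamma> vpos) auto
      then show "norm (unif_pred vx vy \<alpha> x y powr (1 - \<beta>) * gauss (y - \<mu>) vy powr \<beta>)
        \<le> norm ((1 - \<beta>) * gauss (y - x) (vy / \<gamma>) + \<beta> * gauss (y - \<mu>) vy)"
        unfolding unif by simp
    qed
    show "(\<lambda>y. unif_pred vx vy \<alpha> x y powr (1 - \<beta>) * gauss (y - \<mu>) vy powr \<beta>) \<in> borel_measurable lborel"
      unfolding unif by measurable
  qed
  have unif_loss: "integrable lborel (\<lambda>y. f_alpha \<alpha> (unif_pred vx vy \<alpha> x y / gauss (y - \<mu>) vy) * gauss (y - \<mu>) vy)" for x
    unfolding f_alpha_ratio[OF alpha unif_nonneg gauss_pos[OF vpos(2)]]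
    by (rule integrable_mult_right[OF Bochner_Integration.integrable_diff[OF integrable_gauss[OF vpos(2)]
          unif_int[unfolded \<beta>_def]]])
  have unif_meas: "(\<lambda>x. \<integral>y. unif_pred vx vy \<alpha> x y powr (1 - beta_of \<alpha>) * gauss (y - \<mu>) vy powr beta_of \<alpha> \<partial>lborel) \<in> borel_measurable borel"
    unfolding unif by measurable
  have "affinity \<alpha> vx vy (unif_pred vx vy \<alpha>) \<mu> < \<infinity>" by (simp add: aff_unif)
  note risk_unif = risk_eq_affinity[OF alpha vpos unif_nonneg unif_loss disjI2[OF conjI[OF unif_meas this]]]
  \<comment> \<open>Finiteness of the Bayes affinity is essential here, because
    \<open>enn2real\<close> would send an infinite value to 0.\<close>
  have "enn2real (affinity \<alpha> vx vy (unif_pred vx vy \<alpha>) \<mu>) \<le> enn2real (affinity \<alpha> vx vy (bayes_pred prior vx vy \<alpha>) \<mu>)"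
    using aff_bayes risk_bayes(1) by (intro enn2real_mono) (auto simp: aff_unif)
  moreover have "4 / (1 - \<alpha>\<^sup>2) > 0" using alpha abs_square_less_1[of \<alpha>] by (simp add: abs_less_iff)
  ultimately show ?thesis unfolding risk_bayes(2) risk_unif(2) by (intro mult_left_mono) auto
qed

end
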